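(* Let $\sigma>1$ and let $\varphi\in C^\infty(\mathbb R)$. Call a pair of sequences $(\alpha_n)_{n\in\mathbb N_0}$, $(\beta_m)_{m\in\mathbb N_0}$ admissible if both are strictly increasing sequences of non-negative integers tending to infinity, $\alpha_0=\beta_0=0$, and there is $L>1$ such that $\alpha_{n+1}/\alpha_n\le L$ and $\beta_{n+1}/\beta_n\le L$ for all $n\in\mathbb N=\{1,2,\dots\}$. Then the following conditions are equivalent: 1. $\varphi\in\mathcal S_{\{\mathcal M_\sigma\}}^{\{\mathcal M_\sigma\}}(\mathbb R)$. 2. There exist an admissible pair $(\alpha_n)$, $(\beta_m)$ and $\tau,C>0$ such that for all $m,n\in\mathbb N_0$ $$\sup_{x\in\mathbb R}|x^{\alpha_n}\varphi(x)|\le C M_{\alpha_n}^{\tau,\sigma}\quad\text{and}\quad \sup_{x\in\mathbb R}|\varphi^{(\beta_m)}(x)|\le C M_{\beta_m}^{\tau,\sigma}.$$ 3. There exist an admissible pair $(\alpha_n)$, $(\beta_m)$ and $\tau,C>0$ such that for all $m,n\in\mathbb N_0$ $$\sup_{x\in\mathbb R}|x^{\alpha_n}\varphi(x)|\le C M_{\alpha_n}^{\tau,\sigma}\quad\text{and}\quad \sup_{\xi\in\mathbb R}|\xi^{\beta_m}\widehat\varphi(\xi)|\le C M_{\beta_m}^{\tau,\sigma}.$$ 4. There exist an admissible pair $(\alpha_n)$, $(\beta_m)$ and $\tau,C>0$ such that for all $m,n\in\mathbb N_0$ $$\sup_{\xi\in\mathbb R}|\widehat\varphi^{(\alpha_n)}(\xi)|\le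 C M_{\alpha_n}^{\tau,\sigma}\quad\text{and}\quad \sup_{\xi\in\mathbb R}|\xi^{\beta_m}\widehat\varphi(\xi)|\le C M_{\beta_m}^{\tau,\sigma}.$$ 5. There exist an admissible pair $(\alpha_n)$, $(\beta_m)$ and $\tau>0$ such that $$\sup_{x\in\mathbb R}|\varphi(x)|e^{T_{\tau,\sigma,(\alpha_n)}(|x|)}<\infty\quad\text{and}\quad \sup_{\xi\in\mathbb R}|\widehat\varphi(\xi)|e^{T_{\tau,\sigma,(\beta_n)}(|\xi|)}<\infty .$$
   Context: $\mathbb N_0=\{0,1,2,\dots\}$. For $\tau>0$, $\sigma>1$ put $M_0^{\tau,\sigma}=1$ and $M_n^{\tau,\sigma}=n^{\tau n^\sigma}$ for integers $n\ge1$; the weight matrix is $\mathcal M_\sigma=\{(M_n^{\tau,\sigma})_{n\in\mathbb N_0}:\tau>0\}$. The extended Gelfand--Shilov space of Roumieu type $\mathcal S_{\{\mathcal M_\sigma\}}^{\{\mathcal M_\sigma\}}(\mathbb R)$ is the set of all $\varphi\in C^\infty(\mathbb R)$ for which there exist $\tau>0$ and $C>0$ such that $\sup_{x\in\mathbb R}|x^\alpha\varphi^{(\beta)}(x)|\le C M_\alpha^{\tau,\sigma}M_\beta^{\tau,\sigma}$ for all $\alpha,\beta\in\mathbb N_0$. For a sequence $(d_n)_{n\in\mathbb N_0}$ of non-negative integers with $d_0=0$ and $d_n\to\infty$, $$T_{\tau,\sigma,(d_n)}(x)=\sup_{n\in\mathbb N_0}\ln\frac{x^{d_n}}{M_{d_n}^{\tau,\sigma}},\qquad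 x\ge0$$ (with $0^0=1$). $\widehat\varphi$ denotes the Fourier transform of $\varphi$, given for $\varphi$ in the extended Gelfand--Shilov space by $\widehat\varphi(\xi)=\int_{\mathbb R}\varphi(x)e^{-2\pi i x\xi}\,dx$, $\xi\in\mathbb R$. *)

theory Defs
  imports "HOL-Probability.Probability"
begin

section \<open>Smooth functions and the weight matrix\<close>

definition nth_deriv :: "nat \<Rightarrow> (real \<Rightarrow> complex) \<Rightarrow> real \<Rightarrow> complex" where
  "nth_deriv n f = ((\<lambda>g x. vector_derivative g (at x)) ^^ n) f"

definition smooth :: "(real \<Rightarrow> complex) \<Rightarrow> bool" where
  "smooth f \<longleftrightarrow> (\<forall>n x. nth_deriv n f differentiable (at x))"

text \<open>The case distinction is needed because \<open>0 powr a = 0\<close>.\<close>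

definition weight :: "real \<Rightarrow> real \<Rightarrow> nat \<Rightarrow> real" where
  "weight \<tau> \<sigma> n = (if n = 0 then 1 else real n powr (\<tau> * real n powr \<sigma>))"

definition gelfand_shilov :: "real \<Rightarrow> (real \<Rightarrow> complex) set" where
  "gelfand_shilov \<sigma> = {\<phi>. smooth \<phi> \<and>
     (\<exists>\<tau>>0. \<exists>C>0. \<forall>\<alpha> \<beta> x.
        norm (x ^ \<alpha> *\<^sub>R nth_deriv \<beta> \<phi> x) \<le> C * weight \<tau> \<sigma> \<alpha> * weight \<tau> \<sigma> \<beta>)}"

text \<open>
  The supremum is only meant for \<open>d 0 = 0\<close> and \<open>d n\<close> tending to infinity, when it is finite
  and non-negative. At \<open>x = 0\<close> the terms with \<open>d n > 0\<close> are \<open>ln 0\<close>, which is \<open>0\<close> in HOL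
  rather than minus infinity; as the term with \<open>n = 0\<close> is \<open>0\<close>, the supremum is not affected.
\<close>

definition assoc_fun :: "real \<Rightarrow> real \<Rightarrow> (nat \<Rightarrow> nat) \<Rightarrow> real \<Rightarrow> real" where
  "assoc_fun \<tau> \<sigma> d x = (SUP n. ln (x ^ d n / weight \<tau> \<sigma> (d n)))"

definition admissible :: "(nat \<Rightarrow> nat) \<Rightarrow> (nat \<Rightarrow> nat) \<Rightarrow> bool" where
  "admissible \<alpha> \<beta> \<longleftrightarrow>
     strict_mono \<alpha> \<and> strict_mono \<beta> \<and>
     filterlim \<alpha> at_top sequentially \<and> filterlim \<beta> at_top sequentially \<and>
     \<alpha> 0 = 0 \<and> \<beta> 0 = 0 \<and>
     (\<exists>L::real. L > 1 \<and>
        (\<forall>n\<ge>1. real (\<alpha> (Suc n)) / real (\<alpha> n) \<le> L \<and> real (\<beta> (Suc n)) / real (\<beta> n) \<le> L))"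


section \<open>The Fourier transform\<close>

definition fourier_integral :: "(real \<Rightarrow> complex) \<Rightarrow> real \<Rightarrow> complex" where
  "fourier_integral f \<xi> =
     (LINT x|lborel. f x * exp (- (2 * of_real pi * \<i> * of_real x * of_real \<xi>)))"

definition schwartz :: "(real \<Rightarrow> complex) set" where
  "schwartz = {\<psi>. smooth \<psi> \<and> (\<forall>\<alpha> \<beta>. bounded (range (\<lambda>x. x ^ \<alpha> *\<^sub>R nth_deriv \<beta> \<psi> x)))}"

text \<open>
  Functions that are tempered distributions: continuity of the functional given by \<open>f\<close> on the
  Schwartz space follows from the Banach-Steinhaus theorem.
\<close>

definition tempered :: "(real \<Rightarrow> complex) \<Rightarrow> bool" where
  "tempered f \<longleftrightarrow> f \<in> borel_measurable lborel \<and>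
     (\<forall>\<psi>\<in>schwartz. integrable lborel (\<lambda>x. f x * \<psi> x))"

text \<open>
  A smooth function need not be integrable, and the Bochner integral of a non-integrable function
  is \<open>0\<close> in HOL, so \<open>fourier_integral\<close> alone does not describe the Fourier transform of an
  arbitrary smooth function (for a constant \<open>f\<close> it would vanish identically). Hence the Fourier
  transform is taken in the sense of tempered distributions: \<open>g\<close> is the (unique) continuous
  function representing it. For integrable \<open>f\<close> it is given by the integral, as shown below.
\<close>

definition has_fourier_transform :: "(real \<Rightarrow> complex) \<Rightarrow> (real \<Rightarrow> complex) \<Rightarrow> bool" where
  "has_fourier_transform f g \<longleftrightarrow> tempered f \<and> tempered g \<and> continuous_on UNIV g \<and>
     (\<forall>\<psi>\<in>schwartz. (LINT \<xi>|lborel. g \<xi> * \<psi> \<xi>) = (LINT x|lborel. f x * fourier_integral \<psi> x))"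

lemma schwartz_integrable:
  assumes "\<psi> \<in> schwartz"
  shows "integrable lborel \<psi>" "bounded (range \<psi>)"
proof -
  have sm: "smooth \<psi>" and b: "\<And>\<alpha> \<beta>. bounded (range (\<lambda>x. x ^ \<alpha> *\<^sub>R nth_deriv \<beta> \<psi> x))"
    using assms by (auto simp: schwartz_def)
  have d0: "nth_deriv 0 \<psi> = \<psi>" by (simp add: nth_deriv_def)
  show b0: "bounded (range \<psi>)" using b[of 0 0] by (simp add: d0)
  have "\<psi> differentiable (at x)" for x using sm d0 unfolding smooth_def by metis
  then have cont: "continuous_on UNIV \<psi>"
    by (simp add: continuous_at_imp_continuous_on differentiable_imp_continuous_within)
  obtain B0 where B0: "\<And>x. norm (\<psi> x) \<le> B0" using b0 by (auto simp: bounded_iff)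
  obtain B2 where B2: "\<And>x. norm (x ^ 2 *\<^sub>R \<psi> x) \<le> B2"
    using b[of 2 0] by (auto simp: bounded_iff d0)
  have le: "norm (\<psi> x) \<le> norm ((B0 + B2) * inverse (1 + x^2))" for x
  proof -
    have "(1 + x^2) * norm (\<psi> x) \<le> B0 + B2"
      using B0[of x] B2[of x] by (simp add: algebra_simps)
    then have "norm (\<psi> x) \<le> (B0 + B2) * inverse (1 + x^2)"
      by (simp add: field_simps add_pos_nonneg)
    also have "\<dots> \<le> norm \<dots>" by simp
    finally show ?thesis .
  qed
  have "integrable lborel (\<lambda>x::real. inverse (1 + x^2))"
    using integrable_inverse_1_plus_square by (simp add: set_integrable_def)
  then have "integrable lborel (\<lambda>x. (B0 + B2) * inverse (1 + x^2))" by simp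
  then show "integrable lborel \<psi>"
    by (rule Bochner_Integration.integrable_bound)
       (use le borel_measurable_continuous_onI[OF cont] in auto)
qed

lemma has_fourier_transform_fourier_integral:
  assumes f: "integrable lborel f"
  shows "has_fourier_transform f (fourier_integral f)"
proof -
  define e :: "real \<Rightarrow> real \<Rightarrow> complex" where
    "e x y = exp (- (2 * of_real pi * \<i> * of_real x * of_real y))" for x y
  have ne: "norm (e x y) = 1" for x y by (simp add: e_def norm_exp_eq_Re)
  have em[measurable]: "(\<lambda>(x, y). e x y) \<in> borel_measurable (borel \<Otimes>\<^sub>M borel)"
    unfolding e_def borel_prod by (intro borel_measurable_continuous_onI) (auto simp: split_beta intro!: continuous_intros)
  have em1[measurable]: "(\<lambda>x. e x y) \<in> borel_measurable borel" for y
    unfolding e_def by (intro borel_measurable_continuous_onI continuous_intros)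
  have FI: "fourier_integral h y = (LINT x|lborel. h x * e x y)" for h y
    by (simp add: fourier_integral_def e_def)
  have bnd: "norm (fourier_integral h y) \<le> (LINT x|lborel. norm (h x))" for h y
    unfolding FI using integral_norm_bound[of lborel "\<lambda>x. h x * e x y"]
    by (simp add: norm_mult ne)
  have cont: "continuous_on UNIV (fourier_integral h)" if h: "integrable lborel h" for h
    unfolding continuous_on_eq_continuous_at[OF open_UNIV] continuous_at_sequentially
  proof (intro ballI allI impI)
    fix y and u :: "nat \<Rightarrow> real" assume u: "u \<longlonglongrightarrow> y"
    have hm[measurable]: "h \<in> borel_measurable borel" using h by auto
    have "(\<lambda>n. LINT x|lborel. h x * e x (u n)) \<longlonglongrightarrow> (LINT x|lborel. h x * e x y)"
    proof (rule integral_dominated_convergence[where w = "\<lambda>x. norm (h x)"])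
      show "AE x in lborel. (\<lambda>n. h x * e x (u n)) \<longlonglongrightarrow> h x * e x y"
        unfolding e_def by (intro AE_I2 tendsto_intros u)
    qed (use h in \<open>auto simp: norm_mult ne\<close>)
    then show "(fourier_integral h \<circ> u) \<longlonglongrightarrow> fourier_integral h y"
      by (simp add: FI o_def)
  qed
  have prod: "integrable lborel (\<lambda>x. h x * \<psi> x)"
    if h: "h \<in> borel_measurable lborel" "\<And>x. norm (h x) \<le> B" and \<psi>: "integrable lborel \<psi>"
    for h \<psi> :: "real \<Rightarrow> complex" and B
    by (rule Bochner_Integration.integrable_bound[of lborel "\<lambda>x. of_real B * \<psi> x"])
       (use h \<psi> in \<open>auto simp: norm_mult intro!: mult_right_mono order_trans[OF h(2)]\<close>)
  have tf: "tempered f"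
    unfolding tempered_def
  proof (intro conjI ballI)
    show "f \<in> borel_measurable lborel" using f by auto
    fix \<psi> assume "\<psi> \<in> schwartz"
    note s = schwartz_integrable[OF this]
    obtain B where "\<And>x. norm (\<psi> x) \<le> B" using s(2) by (auto simp: bounded_iff)
    then have "integrable lborel (\<lambda>x. \<psi> x * f x)" using s(1) f by (intro prod) auto
    then show "integrable lborel (\<lambda>x. f x * \<psi> x)" by (simp add: mult.commute)
  qed
  have tg: "tempered (fourier_integral f)"
    unfolding tempered_def
  proof (intro conjI ballI)
    show m: "fourier_integral f \<in> borel_measurable lborel"
      using borel_measurable_continuous_onI[OF cont[OF f]] by simp
    fix \<psi> assume "\<psi> \<in> schwartz"
    then show "integrable lborel (\<lambda>x. fourier_integral f x * \<psi> x)"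
      using schwartz_integrable(1) m bnd by (intro prod) auto
  qed
  have "(LINT y|lborel. fourier_integral f y * \<psi> y) = (LINT x|lborel. f x * fourier_integral \<psi> x)"
    if "\<psi> \<in> schwartz" for \<psi>
  proof -
    have \<psi>: "integrable lborel \<psi>" using schwartz_integrable(1) that .
    have [measurable]: "f \<in> borel_measurable borel" "\<psi> \<in> borel_measurable borel"
      using f \<psi> by auto
    have int: "integrable (lborel \<Otimes>\<^sub>M lborel) (\<lambda>(x, y). f x * e x y * \<psi> y)"
    proof (rule lborel_pair.Fubini_integrable)
      show "integrable lborel (\<lambda>x. LINT y|lborel. norm (case (x, y) of (x, y) \<Rightarrow> f x * e x y * \<psi> y))"
        using f by (simp add: norm_mult ne)
      show "AE x in lborel. integrable lborel (\<lambda>y. case (x, y) of (x, y) \<Rightarrow> f x * e x y * \<psi> y)"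
      proof (rule AE_I2)
        fix x
        have "(\<lambda>y. e x y) \<in> borel_measurable borel" by measurable
        then show "integrable lborel (\<lambda>y. case (x, y) of (x, y) \<Rightarrow> f x * e x y * \<psi> y)"
          using \<psi> by (auto simp: norm_mult ne intro!: prod[where B = "norm (f x)"])
      qed
    qed simp
    have "(LINT y|lborel. fourier_integral f y * \<psi> y) = (LINT y|lborel. LINT x|lborel. f x * e x y * \<psi> y)"
      by (simp add: FI)
    also have "\<dots> = (LINT x|lborel. LINT y|lborel. f x * e x y * \<psi> y)"
      using lborel_pair.Fubini_integral[OF int] .
    also have "\<dots> = (LINT x|lborel. f x * fourier_integral \<psi> x)"
    proof (rule Bochner_Integration.integral_cong[OF refl])
      fix x
      have "(LINT y|lborel. f x * e x y * \<psi> y) = (LINT y|lborel. f x * (\<psi> y * e y x))"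
        by (rule Bochner_Integration.integral_cong[OF refl]) (simp add: e_def mult_ac)
      then show "(LINT y|lborel. f x * e x y * \<psi> y) = f x * fourier_integral \<psi> x"
        by (simp add: FI)
    qed
    finally show ?thesis .
  qed
  with tf tg cont[OF f] show ?thesis by (simp add: has_fourier_transform_def)
qed

end

theory Submission
  imports Defs "HOL-Real_Asymp.Real_Asymp"
begin

text \<open>
  Since \<open>\<sigma> > 1\<close>, factors such as \<open>a ^ n\<close>, \<open>n ^ n\<close> and a dilation of the index are absorbed by a
  larger \<open>\<tau>\<close>. Hence the gaps of admissible sequences can be filled: for moments trivially, for
  derivatives by a Landau inequality. A Landau inequality on half-lines, applied at the scale
  \<open>\<bar>x\<bar> powr (- \<alpha> / \<beta>)\<close>, bounds the mixed seminorms by the pure ones, so that decay of \<open>\<phi>\<close>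
  together with bounds on its derivatives already places \<open>\<phi>\<close> in the space. The Fourier
  transform exchanges moments and derivatives, and a continuous function whose
  distributional Fourier transform is integrable is the inverse Fourier integral of the latter.
  The associated function encodes exactly the moment bounds with the same \<open>\<tau>\<close>.
\<close>

subsection \<open>Sequences dominated by the weight matrix\<close>

text \<open>Crude constants suffice: \<open>landau_const n\<close> is at most 4^n n^n for n > 0,
  which the weights absorb, so an elementary half-line argument can stand in for sharp interpolation
  constants. Half-lines are forced by the weights: |x|^n stays bounded below along the ray from x
  away from the origin, while the whole line contains points where no decay is available.
  Interpolation yields a sum of a moment bound and a derivative bound, whereas the space asks for a
  product; u + v <= (u + 1) (v + 1) for u, v >= 0 bridges this. The other obstacle is
  \<open>cond4\<close>, where initially \<phi> is only known to be smooth and tempered. Inversion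
  must therefore allow growth of \<phi>, and tails are controlled by integrability against one fixed
  normal density. The predicate \<open>wbdd\<close> forgets \<tau> and C, so that sums, products and
  affine changes of index can be formed without tracking the parameter.\<close>

definition wbdd :: "real \<Rightarrow> (nat \<Rightarrow> real) \<Rightarrow> bool" where
  "wbdd \<sigma> u \<longleftrightarrow> (\<exists>\<tau>>0. \<exists>C>0. \<forall>n. u n \<le> C * weight \<tau> \<sigma> n)"

lemma weight_ge_1: "\<tau> \<ge> 0 \<Longrightarrow> 1 \<le> weight \<tau> \<sigma> n"
  by (auto simp: weight_def intro!: ge_one_powr_ge_zero)

lemma weight_0: "weight \<tau> \<sigma> 0 = 1"
  by (simp add: weight_def)

lemma weight_add: "weight (\<tau> + \<tau>') \<sigma> n = weight \<tau> \<sigma> n * weight \<tau>' \<sigma> n"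
  by (simp add: weight_def distrib_right powr_add)

lemma weight_mono_param: "\<tau> \<le> \<tau>' \<Longrightarrow> weight \<tau> \<sigma> n \<le> weight \<tau>' \<sigma> n"
  by (auto simp: weight_def intro!: powr_mono mult_right_mono)

lemma weight_mono:
  assumes "\<tau> \<ge> 0" "\<sigma> \<ge> 0" "m \<le> n"
  shows "weight \<tau> \<sigma> m \<le> weight \<tau> \<sigma> n"
proof (cases "m = 0")
  case True
  then show ?thesis using weight_ge_1[OF assms(1)] by (simp add: weight_0)
next
  case False
  have "real m powr (\<tau> * real m powr \<sigma>) \<le> real n powr (\<tau> * real m powr \<sigma>)"
    using False assms by (intro powr_mono2) auto
  also have "\<dots> \<le> real n powr (\<tau> * real n powr \<sigma>)"
    using False assms by (intro powr_mono mult_left_mono powr_mono2) auto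
  finally show ?thesis using False assms by (simp add: weight_def)
qed

text \<open>At n = 0 and n = 1 every weight equals 1, so only the constant can absorb the values
  there. For n >= 2 one has ln n >= ln 2 > 0, and enlarging \<tau> is effective.\<close>

lemma wbddI_ge_2:
  assumes "\<tau> > 0" "\<And>n. n \<ge> 2 \<Longrightarrow> u n \<le> C * weight \<tau> \<sigma> n"
  shows "wbdd \<sigma> u"
  unfolding wbdd_def
proof (intro exI conjI allI)
  define K where "K = \<bar>C\<bar> + \<bar>u 0\<bar> + \<bar>u 1\<bar> + 1"
  show "\<tau> > 0" "K > 0" using assms by (auto simp: K_def)
  fix n
  have w: "1 \<le> weight \<tau> \<sigma> n" using weight_ge_1 assms(1) by simp
  show "u n \<le> K * weight \<tau> \<sigma> n"
  proof (cases "n \<ge> 2")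
    case True
    show ?thesis
      by (rule order_trans[OF assms(2)[OF True]]) (use w in \<open>auto simp: K_def intro!: mult_right_mono\<close>)
  next
    case False
    then have "n = 0 \<or> n = 1" by auto
    then have "u n \<le> K * 1" by (auto simp: K_def)
    also have "\<dots> \<le> K * weight \<tau> \<sigma> n" using w by (intro mult_left_mono) (auto simp: K_def)
    finally show ?thesis .
  qed
qed

lemma wbdd_mono:
  assumes "wbdd \<sigma> v" "\<And>n. u n \<le> v n"
  shows "wbdd \<sigma> u"
  using assms unfolding wbdd_def by (meson order_trans)

lemma wbdd_mult:
  assumes "wbdd \<sigma> u" "wbdd \<sigma> v" "\<And>n. 0 \<le> u n" "\<And>n. 0 \<le> v n"
  shows "wbdd \<sigma> (\<lambda>n. u n * v n)"
proof -
  obtain t C where 1: "t > 0" "C > 0" "\<And>n. u n \<le> C * weight t \<sigma> n" using assms(1) by (auto simp: wbdd_def)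
  obtain t' C' where 2: "t' > 0" "C' > 0" "\<And>n. v n \<le> C' * weight t' \<sigma> n" using assms(2) by (auto simp: wbdd_def)
  have "u n * v n \<le> (C * C') * weight (t + t') \<sigma> n" for n
  proof -
    have "u n * v n \<le> (C * weight t \<sigma> n) * (C' * weight t' \<sigma> n)"
      using 1(3)[of n] 2(3)[of n] assms(3,4)[of n] by (intro mult_mono) auto
    then show ?thesis by (simp add: weight_add mult_ac)
  qed
  moreover have "t + t' > 0" "C * C' > 0" using 1 2 by auto
  ultimately show ?thesis unfolding wbdd_def by blast
qed

lemma wbdd_common:
  assumes "wbdd \<sigma> u" "wbdd \<sigma> v"
  obtains \<tau> C where "\<tau> > 0" "C > 0" "\<And>n. u n \<le> C * weight \<tau> \<sigma> n" "\<And>n. v n \<le> C * weight \<tau> \<sigma> n"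
proof -
  obtain t C where 1: "t > 0" "C > 0" "\<And>n. u n \<le> C * weight t \<sigma> n" using assms(1) by (auto simp: wbdd_def)
  obtain t' C' where 2: "t' > 0" "C' > 0" "\<And>n. v n \<le> C' * weight t' \<sigma> n" using assms(2) by (auto simp: wbdd_def)
  have w: "c * weight r \<sigma> n \<le> max C C' * weight (max t t') \<sigma> n"
    if "0 < c" "c \<le> max C C'" "0 < r" "r \<le> max t t'" for c r n
    using that weight_ge_1[of r \<sigma> n] by (intro mult_mono weight_mono_param) auto
  show ?thesis
  proof (rule that)
    show "u n \<le> max C C' * weight (max t t') \<sigma> n" for n
      using 1 by (intro order_trans[OF 1(3) w]) auto
    show "v n \<le> max C C' * weight (max t t') \<sigma> n" for n
      using 2 by (intro order_trans[OF 2(3) w]) auto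
  qed (use 1 2 in auto)
qed

lemma wbdd_add:
  assumes "wbdd \<sigma> u" "wbdd \<sigma> v"
  shows "wbdd \<sigma> (\<lambda>n. u n + v n)"
proof -
  obtain t C where C: "t > 0" "C > 0" "\<And>n. u n \<le> C * weight t \<sigma> n" "\<And>n. v n \<le> C * weight t \<sigma> n"
    using wbdd_common[OF assms] by blast
  have "u n + v n \<le> (2 * C) * weight t \<sigma> n" for n using C(3)[of n] C(4)[of n] by simp
  moreover have "2 * C > 0" using C by simp
  ultimately show ?thesis unfolding wbdd_def using C(1) by blast
qed

lemma wbdd_const: "wbdd \<sigma> (\<lambda>n. c)"
proof (rule wbddI_ge_2)
  fix n
  have "c \<le> \<bar>c\<bar> * 1" by simp
  also have "\<dots> \<le> \<bar>c\<bar> * weight 1 \<sigma> n" by (intro mult_left_mono weight_ge_1) auto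
  finally show "c \<le> \<bar>c\<bar> * weight 1 \<sigma> n" .
qed simp

lemma wbdd_self_power:
  assumes "\<sigma> \<ge> 1"
  shows "wbdd \<sigma> (\<lambda>n. real n ^ n)"
proof (rule wbddI_ge_2)
  fix n :: nat assume n: "n \<ge> 2"
  have "real n ^ n = real n powr (real n powr 1)" using n by (simp add: powr_realpow)
  also have "\<dots> \<le> real n powr (real n powr \<sigma>)" using n assms by (intro powr_mono) auto
  finally show "real n ^ n \<le> 1 * weight 1 \<sigma> n" using n by (simp add: weight_def)
qed simp

text \<open>With a < 2^k, the power a^n is at most (2^n)^k <= (n^n)^k for n >= 2, and a k-fold
  product of n^n stays in the class.\<close>

lemma wbdd_power:
  assumes "\<sigma> \<ge> 1" "a \<ge> 0"
  shows "wbdd \<sigma> (\<lambda>n. a ^ n)"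
proof -
  obtain k :: nat where k: "a < 2 ^ k" using real_arch_pow[of 2 a] by auto
  have p: "wbdd \<sigma> (\<lambda>n. (real n ^ n) ^ k)"
  proof (induction k)
    case (Suc k)
    then show ?case using wbdd_mult[OF wbdd_self_power[OF assms(1)] Suc] by simp
  qed (simp add: wbdd_const)
  obtain t C where 1: "t > 0" "\<And>n. (real n ^ n) ^ k \<le> C * weight t \<sigma> n"
    using p by (auto simp: wbdd_def)
  show ?thesis
  proof (rule wbddI_ge_2[OF 1(1)])
    fix n :: nat assume n: "n \<ge> 2"
    have "a ^ n \<le> (2 ^ k) ^ n" using k assms by (intro power_mono) auto
    also have "\<dots> = (2 ^ n) ^ k" by (simp add: power_mult[symmetric] mult.commute)
    also have "\<dots> \<le> (real n ^ n) ^ k" using n by (intro power_mono) auto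
    also note 1(2)
    finally show "a ^ n \<le> C * weight t \<sigma> n" .
  qed
qed

lemma wbdd_weight_dilate:
  assumes "\<tau> > 0" "\<sigma> \<ge> 0"
  shows "wbdd \<sigma> (\<lambda>n. weight \<tau> \<sigma> (k * n))"
proof (cases "k = 0")
  case True
  then show ?thesis by (simp add: wbdd_const)
next
  case k: False
  \<comment> \<open>The factor k^\<sigma> comes from (k n)^\<sigma>; the last factor comes from ln
    (k n) <= (1 + ln k / ln 2) ln n, valid for n >= 2.\<close>
  define t where "t = \<tau> * real k powr \<sigma> * (1 + ln (real k) / ln 2)"
  have t: "t > 0" unfolding t_def using k assms by (intro mult_pos_pos add_pos_nonneg) auto
  show ?thesis
  proof (rule wbddI_ge_2[OF t])
    fix n :: nat assume n: "n \<ge> 2"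
    have "ln (real (k * n)) = ln (real k) / ln 2 * ln 2 + ln (real n)"
      using k n by (simp add: ln_mult)
    also have "\<dots> \<le> ln (real k) / ln 2 * ln (real n) + ln (real n)"
      using k n by (intro add_right_mono mult_left_mono) auto
    also have "\<dots> = (1 + ln (real k) / ln 2) * ln (real n)" by (simp add: algebra_simps)
    finally have l: "ln (real (k * n)) \<le> (1 + ln (real k) / ln 2) * ln (real n)" .
    have "weight \<tau> \<sigma> (k * n) = exp (\<tau> * (real k powr \<sigma> * real n powr \<sigma>) * ln (real (k * n)))"
      using k n by (simp add: weight_def powr_def[of "real k * real n"] powr_mult[symmetric])
    also have "\<dots> \<le> exp (\<tau> * (real k powr \<sigma> * real n powr \<sigma>) * ((1 + ln (real k) / ln 2) * ln (real n)))"
      unfolding exp_le_cancel_iff using assms by (intro mult_left_mono l) auto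
    also have "\<dots> = exp (t * real n powr \<sigma> * ln (real n))" by (simp add: t_def mult_ac)
    also have "\<dots> = weight t \<sigma> n" using n by (simp add: weight_def powr_def[of "real n" "t * real n powr \<sigma>"])
    finally show "weight \<tau> \<sigma> (k * n) \<le> 1 * weight t \<sigma> n" by simp
  qed
qed

text \<open>For n >= 1 the index k n + c is at most (k + c) n, and the weights increase with the
  index, so a dilation suffices.\<close>

lemma wbdd_affine:
  assumes "wbdd \<sigma> u" "\<sigma> \<ge> 0"
  shows "wbdd \<sigma> (\<lambda>n. u (k * n + c))"
proof -
  obtain t C where 1: "t > 0" "C > 0" "\<And>n. u n \<le> C * weight t \<sigma> n" using assms(1) by (auto simp: wbdd_def)
  obtain t' C' where 2: "t' > 0" "C' > 0" "\<And>n. weight t \<sigma> ((k + c) * n) \<le> C' * weight t' \<sigma> n"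
    using wbdd_weight_dilate[OF 1(1) assms(2), of "k + c"] by (auto simp: wbdd_def)
  show ?thesis
  proof (rule wbddI_ge_2[OF 2(1)])
    fix n :: nat assume n: "n \<ge> 2"
    have "u (k * n + c) \<le> C * weight t \<sigma> (k * n + c)" by (rule 1)
    also have "\<dots> \<le> C * weight t \<sigma> ((k + c) * n)"
      using 1 n assms by (intro mult_left_mono weight_mono) (auto simp: algebra_simps)
    also have "\<dots> \<le> C * (C' * weight t' \<sigma> n)" using 1 2 by (intro mult_left_mono) auto
    finally show "u (k * n + c) \<le> (C * C') * weight t' \<sigma> n" by simp
  qed
qed

subsection \<open>Landau inequalities\<close>

text \<open>The factor 2^n comes from repeated differencing in \<open>halfline_deriv_bound\<close>;
  each order descended from n costs a further factor of at most n + 1.\<close>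

definition landau_const :: "nat \<Rightarrow> real" where
  "landau_const n = 2 ^ n * (real n + 1) ^ n"

lemma landau_const_ge_1: "landau_const n \<ge> 1"
  unfolding landau_const_def using mult_mono[of 1 "2 ^ n" 1 "(real n + 1) ^ n"] by simp

lemma landau_const_mono: "m \<le> n \<Longrightarrow> landau_const m \<le> landau_const n"
  unfolding landau_const_def
  by (intro mult_mono power_increasing order_trans[OF power_mono power_increasing]) auto

lemma wbdd_landau_const:
  assumes "\<sigma> \<ge> 1"
  shows "wbdd \<sigma> landau_const"
proof -
  have "wbdd \<sigma> (\<lambda>n. 4 ^ n * real n ^ n + 1)"
    by (intro wbdd_add wbdd_mult wbdd_power wbdd_self_power wbdd_const assms) auto
  then show ?thesis
  proof (rule wbdd_mono)
    fix n :: nat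
    show "landau_const n \<le> 4 ^ n * real n ^ n + 1"
    proof (cases "n = 0")
      case False
      have "landau_const n \<le> 2 ^ n * (2 * real n) ^ n"
        unfolding landau_const_def using False by (intro mult_left_mono power_mono) auto
      also have "\<dots> = (2 * 2) ^ n * real n ^ n" unfolding power_mult_distrib by simp
      finally show ?thesis by simp
    qed (simp add: landau_const_def)
  qed
qed

lemma smooth_nth_deriv:
  assumes "smooth f"
  shows "(nth_deriv n f has_vector_derivative nth_deriv (Suc n) f x) (at x)"
  using assms by (simp add: smooth_def nth_deriv_def vector_derivative_works)

text \<open>Derivatives are handled as towers in which \<open>F (Suc n)\<close> is the derivative of
  \<open>F n\<close>; this identifies such a tower with the iterated
  \<open>vector_derivative\<close>.\<close>

lemma nth_deriv_eqI:
  assumes "\<And>n x. (F n has_vector_derivative F (Suc n) x) (at x)"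
  shows "nth_deriv n (F 0) = F n"
proof (induction n)
  case (Suc n)
  have "nth_deriv (Suc n) (F 0) = (\<lambda>x. vector_derivative (nth_deriv n (F 0)) (at x))"
    by (simp add: nth_deriv_def)
  also have "\<dots> = F (Suc n)" using assms vector_derivative_at by (fastforce simp: Suc)
  finally show ?case .
qed (simp add: nth_deriv_def)

lemma smoothI:
  assumes "\<And>n x. (F n has_vector_derivative F (Suc n) x) (at x)"
  shows "smooth (F 0)"
  unfolding smooth_def nth_deriv_eqI[of F, OF assms]
  using assms by (blast intro: differentiableI_vector)

lemma norm_diff_le_vector_derivative:
  fixes f :: "real \<Rightarrow> 'a::real_normed_vector"
  assumes "a \<le> b" "\<And>t. a \<le> t \<Longrightarrow> t \<le> b \<Longrightarrow> (f has_vector_derivative f' t) (at t)"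
    "\<And>t. a \<le> t \<Longrightarrow> t \<le> b \<Longrightarrow> norm (f' t) \<le> B"
  shows "norm (f b - f a) \<le> B * (b - a)"
proof -
  have "norm (f b - f a) \<le> B * norm (b - a)"
  proof (rule differentiable_bound[of "{a..b}" f "\<lambda>t h. h *\<^sub>R f' t"])
    show "(f has_derivative (\<lambda>h. h *\<^sub>R f' t)) (at t within {a..b})" if "t \<in> {a..b}" for t
      using assms(2)[of t] that by (auto simp: has_vector_derivative_def intro: has_derivative_at_withinI)
    show "onorm (\<lambda>h. h *\<^sub>R f' t) \<le> B" if "t \<in> {a..b}" for t
    proof (rule onorm_le)
      fix h :: real
      show "norm (h *\<^sub>R f' t) \<le> B * norm h"
        using assms(3)[of t] that by (simp add: mult.commute[of B] mult_left_mono)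
    qed
  qed (use assms(1) in auto)
  then show ?thesis using assms(1) by simp
qed

text \<open>Induction via \<open>G (t + 1) - G t\<close>, whose derivatives are close to those of \<open>G\<close> shifted by one.\<close>

lemma halfline_deriv_bound:
  fixes G :: "nat \<Rightarrow> real \<Rightarrow> 'a::real_normed_vector"
  assumes "\<And>i t. (G i has_vector_derivative G (Suc i) t) (at t)"
    "\<And>t. 0 \<le> t \<Longrightarrow> norm (G 0 t) \<le> A" "\<And>t. 0 \<le> t \<Longrightarrow> norm (G (Suc n) t) \<le> B" "0 \<le> t"
  shows "norm (G n t) \<le> 2 ^ n * A + real n * B"
  using assms
proof (induction n arbitrary: G A t)
  case (Suc n)
  note d = Suc.prems(1)
  have B: "0 \<le> B" using order_trans[OF norm_ge_zero Suc.prems(3)[of 0]] by simp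
  \<comment> \<open>Member \<open>Suc n\<close> of the difference tower obeys the same bound B, so B
    survives the induction while A doubles.\<close>
  have inc: "norm (G (Suc n) (t + 1) - G (Suc n) t) \<le> B" if "0 \<le> t" for t
    using norm_diff_le_vector_derivative[of t "t + 1" "G (Suc n)" "G (Suc (Suc n))" B] d Suc.prems(3) that
    by simp
  have "norm (G n (t + 1) - G n t) \<le> 2 ^ n * (2 * A) + real n * B"
  proof (rule Suc.IH[of "\<lambda>i t. G i (t + 1) - G i t"])
    fix i t
    have "((\<lambda>t. G i (t + 1)) has_vector_derivative G (Suc i) (t + 1)) (at t)"
    proof -
      have "((\<lambda>t. t + 1) has_vector_derivative 1) (at t)" by (auto intro!: derivative_eq_intros)
      from vector_diff_chain_at[OF this d[of i]] show ?thesis by (simp add: o_def)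
    qed
    then show "((\<lambda>t. G i (t + 1) - G i t) has_vector_derivative G (Suc i) (t + 1) - G (Suc i) t) (at t)"
      using d by (intro has_vector_derivative_diff)
  next
    fix t :: real assume "0 \<le> t"
    then show "norm (G 0 (t + 1) - G 0 t) \<le> 2 * A"
      using Suc.prems(2)[of t] Suc.prems(2)[of "t + 1"] norm_triangle_ineq4[of "G 0 (t + 1)" "G 0 t"] by simp
  qed (use inc Suc.prems in auto)
  \<comment> \<open>Subtracting a linear function with slope \<open>G (Suc n) t\<close> shows that
    the unit difference of \<open>G n\<close> misses this slope by at most B; these errors add up to
    the term n B.\<close>
  moreover have "norm ((G n (t + 1) - (t + 1) *\<^sub>R G (Suc n) t) - (G n t - t *\<^sub>R G (Suc n) t)) \<le> B * (t + 1 - t)"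
  proof (rule norm_diff_le_vector_derivative[where f = "\<lambda>r. G n r - r *\<^sub>R G (Suc n) t"])
    show "((\<lambda>r. G n r - r *\<^sub>R G (Suc n) t) has_vector_derivative G (Suc n) r - G (Suc n) t) (at r)" for r
      by (auto intro!: derivative_eq_intros d)
    fix r assume r: "t \<le> r" "r \<le> t + 1"
    have "norm (G (Suc n) r - G (Suc n) t) \<le> B * (r - t)"
      using r Suc.prems(3,4) d by (intro norm_diff_le_vector_derivative) auto
    also have "\<dots> \<le> B * 1" using r B by (intro mult_left_mono) auto
    finally show "norm (G (Suc n) r - G (Suc n) t) \<le> B" by simp
  qed simp
  then have "norm ((G n (t + 1) - G n t) - G (Suc n) t) \<le> B" by (simp add: algebra_simps)
  ultimately have "norm (G (Suc n) t) \<le> 2 ^ n * (2 * A) + real n * B + B"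
    using norm_triangle_ineq4[of "G n (t + 1) - G n t" "(G n (t + 1) - G n t) - G (Suc n) t"] by simp
  then show ?case by (simp add: algebra_simps)
qed simp

text \<open>Descending induction on j: a bound D for order j + 1 gives 2^j A + j D for order j.
  Keeping 2^n (A + B) as a factor of D ensures 2^j A <= D, so each descent multiplies D by at most n
  + 1.\<close>

lemma landau_halfline:
  fixes G :: "nat \<Rightarrow> real \<Rightarrow> 'a::real_normed_vector"
  assumes d: "\<And>i t. (G i has_vector_derivative G (Suc i) t) (at t)"
    and A: "\<And>t. 0 \<le> t \<Longrightarrow> norm (G 0 t) \<le> A" and B: "\<And>t. 0 \<le> t \<Longrightarrow> norm (G n t) \<le> B"
    and "j \<le> n" "0 \<le> t"
  shows "norm (G j t) \<le> landau_const n * (A + B)"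
proof -
  have AB: "0 \<le> A" "0 \<le> B"
    using order_trans[OF norm_ge_zero A[of 0]] order_trans[OF norm_ge_zero B[of 0]] by auto
  have "norm (G j t) \<le> 2 ^ n * (real n + 1) ^ (n - j) * (A + B)"
    using \<open>j \<le> n\<close> \<open>0 \<le> t\<close>
  proof (induction j arbitrary: t rule: inc_induct)
    case base
    have "norm (G n t) \<le> 1 * (A + B)" using B[OF base] AB by simp
    also have "\<dots> \<le> 2 ^ n * (A + B)" using AB by (intro mult_right_mono) auto
    finally show ?case by simp
  next
    case (step j)
    define D where "D = 2 ^ n * (real n + 1) ^ (n - Suc j) * (A + B)"
    have "2 ^ j * A \<le> 2 ^ n * 1 * (A + B)" using step AB by (intro mult_mono) auto
    also have "\<dots> \<le> D" unfolding D_def using AB by (intro mult_right_mono mult_left_mono) auto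
    finally have "2 ^ j * A + real j * D \<le> D + real j * D" by simp
    also have "\<dots> = (real j + 1) * D" by (simp add: algebra_simps)
    also have "\<dots> \<le> (real n + 1) * D" using step AB by (intro mult_right_mono) (auto simp: D_def)
    also have "\<dots> = 2 ^ n * (real n + 1) ^ Suc (n - Suc j) * (A + B)" by (simp add: D_def)
    also have "Suc (n - Suc j) = n - j" using step by simp
    finally show ?case
      using halfline_deriv_bound[of G A j D t] d A step unfolding D_def by (meson order_trans)
  qed
  also have "\<dots> \<le> landau_const n * (A + B)"
    unfolding landau_const_def using AB by (intro mult_right_mono mult_left_mono power_increasing) auto
  finally show ?thesis .
qed

text \<open>
  The Landau inequality on the half-line pointing away from the origin, applied to
  \<open>t \<mapsto> F (x + e * t)\<close>. The step \<open>e\<close> is chosen with \<open>\<bar>e\<bar> ^ j = \<bar>x\<bar> ^ (- a)\<close>, which gives the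
  bounds of the function and of its derivative of order \<open>2 * j\<close> the same decay \<open>\<bar>x\<bar> ^ (- 2 * a)\<close>.
\<close>

lemma weighted_deriv_bound:
  fixes F :: "nat \<Rightarrow> real \<Rightarrow> 'a::real_normed_vector"
  assumes d: "\<And>i t. (F i has_vector_derivative F (Suc i) t) (at t)"
    and u: "\<And>n t. \<bar>t\<bar> ^ n * norm (F 0 t) \<le> u n" and v: "\<And>n t. norm (F n t) \<le> v n"
    and x: "1 \<le> \<bar>x\<bar>" and j: "j > 0"
  shows "\<bar>x\<bar> ^ a * norm (F j x) \<le> landau_const (2 * j) * (u (2 * a) + v (2 * j))"
proof -
  define X where "X = \<bar>x\<bar> ^ a"
  have X: "X > 0" unfolding X_def using x by (intro zero_less_power) linarith
  define e where "e = sgn x * \<bar>x\<bar> powr (- real a / real j)"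
  have ej: "\<bar>e\<bar> ^ j = inverse X"
    using x j by (auto simp: e_def X_def abs_mult powr_realpow[symmetric] powr_powr powr_minus[symmetric] abs_sgn_eq)
  then have e2: "\<bar>e\<bar> ^ (2 * j) = inverse (X ^ 2)"
    by (simp add: mult.commute[of 2] power_mult power_inverse)
  \<comment> \<open>The step e has the sign of x, so the ray never comes closer to the origin than
    x, and the moment bound keeps the power |x|^(2 a) along it.\<close>
  have sx: "\<bar>x\<bar> \<le> \<bar>x + e * t\<bar>" if "0 \<le> t" for t
  proof (cases "x > 0")
    case True
    then have "0 \<le> e * t" using that by (simp add: e_def)
    then show ?thesis using True by simp
  next
    case False
    then have "e \<le> 0" using x by (simp add: e_def)
    then have "e * t \<le> 0" using that by (simp add: mult_nonpos_nonneg)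
    then show ?thesis using False by simp
  qed
  have "norm (e ^ j *\<^sub>R F j (x + e * 0)) \<le> landau_const (2 * j) * (u (2 * a) / X ^ 2 + v (2 * j) / X ^ 2)"
  proof (rule landau_halfline[of "\<lambda>i t. e ^ i *\<^sub>R F i (x + e * t)"])
    fix i t
    have "((\<lambda>t. x + e * t) has_vector_derivative e) (at t)" by (auto intro!: derivative_eq_intros)
    from bounded_linear.has_vector_derivative[OF bounded_linear_scaleR_right vector_diff_chain_at[OF this d[of i]], of "e ^ i"]
    show "((\<lambda>t. e ^ i *\<^sub>R F i (x + e * t)) has_vector_derivative e ^ Suc i *\<^sub>R F (Suc i) (x + e * t)) (at t)"
      by (simp add: o_def mult.commute)
  next
    fix t :: real assume t: "0 \<le> t"
    have "X ^ 2 * norm (F 0 (x + e * t)) \<le> \<bar>x + e * t\<bar> ^ (2 * a) * norm (F 0 (x + e * t))"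
      unfolding X_def power_mult[symmetric] mult.commute[of a] using sx[OF t] by (intro mult_right_mono power_mono) auto
    also have "\<dots> \<le> u (2 * a)" by (rule u)
    finally show "norm (e ^ 0 *\<^sub>R F 0 (x + e * t)) \<le> u (2 * a) / X ^ 2"
      using X by (simp add: field_simps)
    show "norm (e ^ (2 * j) *\<^sub>R F (2 * j) (x + e * t)) \<le> v (2 * j) / X ^ 2"
      using v[of "2 * j" "x + e * t"] X by (simp add: power_abs e2 divide_inverse mult.commute[of "v _"])
  qed auto
  \<comment> \<open>The rescaling contributes 1/X on the left and 1/X^2 on the right; cancelling one
    factor leaves exactly the weight |x|^a.\<close>
  then have "inverse X * norm (F j x) \<le> inverse X * (inverse X * (landau_const (2 * j) * (u (2 * a) + v (2 * j))))"
    by (simp add: power_abs ej divide_inverse power2_eq_square algebra_simps)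
  then have "norm (F j x) \<le> inverse X * (landau_const (2 * j) * (u (2 * a) + v (2 * j)))"
    using X by (subst (asm) mult_le_cancel_left_pos) auto
  then have "X * norm (F j x) \<le> X * (inverse X * (landau_const (2 * j) * (u (2 * a) + v (2 * j))))"
    using X by (intro mult_left_mono) auto
  then show ?thesis using X by (simp add: X_def[symmetric] mult.assoc[symmetric])
qed

subsection \<open>The Gelfand-Shilov space\<close>

text \<open>Order 0 is controlled by u alone and the region |x| < 1 by v alone. Elsewhere
  \<open>weighted_deriv_bound\<close> applies, and its sum is turned into a product.\<close>

lemma gelfand_shilovI:
  assumes \<sigma>: "\<sigma> > 1" and "smooth f" "wbdd \<sigma> u" "wbdd \<sigma> v"
    and u: "\<And>n x. \<bar>x\<bar> ^ n * norm (f x) \<le> u n" and v: "\<And>n x. norm (nth_deriv n f x) \<le> v n"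
  shows "f \<in> gelfand_shilov \<sigma>"
proof -
  define F where "F n = nth_deriv n f" for n
  have d: "(F i has_vector_derivative F (Suc i) t) (at t)" for i t
    unfolding F_def by (rule smooth_nth_deriv[OF assms(2)])
  have F0: "F 0 = f" by (simp add: F_def nth_deriv_def)
  have nn: "0 \<le> u n" "0 \<le> v n" for n
    using order_trans[OF _ u[of 0 n]] order_trans[OF norm_ge_zero v[of n 0]] by auto
  \<comment> \<open>Chosen so that \<open>a n * b j\<close> dominates all three cases below. The
    summands 1 keep both factors at least 1, and \<open>2 * n + 0\<close> has the shape required by
    \<open>wbdd_affine\<close>.\<close>
  define a b where "a n = u (2 * n + 0) + 1 + u n" and "b n = landau_const (2 * n + 0) * (v (2 * n + 0) + 1) + v n + 1" for n
  have l: "0 \<le> landau_const n" for n using landau_const_ge_1[of n] by simp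
  have "wbdd \<sigma> a" "wbdd \<sigma> b"
    unfolding a_def b_def using nn l \<sigma>
    by (intro wbdd_add wbdd_mult wbdd_const wbdd_affine assms wbdd_landau_const; simp)+
  then obtain \<tau> C where C: "\<tau> > 0" "C > 0" "\<And>n. a n \<le> C * weight \<tau> \<sigma> n" "\<And>n. b n \<le> C * weight \<tau> \<sigma> n"
    by (rule wbdd_common) blast
  have ab1: "1 \<le> a n" "1 \<le> b n" for n
    using nn[of n] nn[of "2 * n"] l[of "2 * n"] by (auto simp: a_def b_def)
  have ab: "\<bar>x\<bar> ^ n * norm (F j x) \<le> a n * b j" for x n j
  proof -
    consider "j = 0" | "j > 0" "\<bar>x\<bar> < 1" | "j > 0" "1 \<le> \<bar>x\<bar>" by fastforce
    then show ?thesis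
    proof cases
      case 1
      have "\<bar>x\<bar> ^ n * norm (F j x) \<le> a n * 1"
        using u[of x n] 1 F0 nn[of "2 * n"] by (simp add: a_def)
      also have "\<dots> \<le> a n * b j" using ab1(1)[of n] ab1(2)[of j] by (intro mult_left_mono) auto
      finally show ?thesis .
    next
      case 2
      have "\<bar>x\<bar> ^ n * norm (F j x) \<le> 1 * v j"
        using 2 v[of j x] nn by (intro mult_mono power_le_one) (auto simp: F_def)
      also have "\<dots> \<le> 1 * b j" using nn l by (simp add: b_def)
      also have "\<dots> \<le> a n * b j" using ab1(1)[of n] ab1(2)[of j] by (intro mult_right_mono) auto
      finally show ?thesis .
    next
      case 3
      have "\<bar>x\<bar> ^ n * norm (F j x) \<le> landau_const (2 * j) * (u (2 * n) + v (2 * j))"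
        using 3 u v by (intro weighted_deriv_bound d) (auto simp: F_def nth_deriv_def)
      also have "\<dots> \<le> landau_const (2 * j) * ((u (2 * n) + 1) * (v (2 * j) + 1))"
        using nn by (intro mult_left_mono l) (simp add: algebra_simps)
      also have "\<dots> = (u (2 * n) + 1) * (landau_const (2 * j) * (v (2 * j) + 1))" by (simp only: mult_ac)
      also have "\<dots> \<le> a n * b j"
        using nn l by (intro mult_mono) (auto simp: a_def b_def)
      finally show ?thesis .
    qed
  qed
  have "norm (x ^ n *\<^sub>R nth_deriv j f x) \<le> C * C * weight \<tau> \<sigma> n * weight \<tau> \<sigma> j" for x n j
  proof -
    have "norm (x ^ n *\<^sub>R nth_deriv j f x) \<le> a n * b j" using ab by (simp add: F_def power_abs)
    also have "\<dots> \<le> (C * weight \<tau> \<sigma> n) * (C * weight \<tau> \<sigma> j)"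
      using C(3)[of n] C(4)[of j] ab1(1)[of n] ab1(2)[of j] by (intro mult_mono) auto
    finally show ?thesis by (simp add: mult_ac)
  qed
  moreover have "C * C > 0" using C by simp
  ultimately show ?thesis unfolding gelfand_shilov_def using C(1) assms(2) by blast
qed

section \<open>Filling the gaps of admissible sequences\<close>

text \<open>Take the least k with n <= \<alpha> k. Its predecessor lies below n, so the ratio bound
  gives \<alpha> k <= L n. The constant c = \<alpha> 1 covers k <= 1, where no ratio bound is
  available.\<close>

lemma gap_index:
  assumes "strict_mono \<alpha>" "\<And>n. n \<ge> 1 \<Longrightarrow> real (\<alpha> (Suc n)) / real (\<alpha> n) \<le> L"
  obtains K c :: nat where "\<And>n. \<exists>k. n \<le> \<alpha> k \<and> \<alpha> k \<le> K * n + c"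
proof (rule that)
  fix n
  define k where "k = (LEAST k. n \<le> \<alpha> k)"
  have k: "n \<le> \<alpha> k" unfolding k_def using strict_mono_imp_increasing[OF assms(1)] by (rule LeastI)
  show "\<exists>k. n \<le> \<alpha> k \<and> \<alpha> k \<le> nat \<lceil>L\<rceil> * n + \<alpha> 1"
  proof (cases "k \<le> 1")
    case True
    then have "\<alpha> k \<le> \<alpha> 1" using assms(1) by (simp add: strict_mono_less_eq)
    then show ?thesis using k by (intro exI[of _ k]) auto
  next
    case False
    then obtain i where i: "k = Suc i" "i \<ge> 1" by (cases k) auto
    have "\<alpha> i < n" using not_less_Least[of i "\<lambda>k. n \<le> \<alpha> k"] i by (simp add: k_def)
    moreover have "0 < \<alpha> i" using assms(1) i by (metis gr0I less_nat_zero_code not_one_le_zero strict_mono_less)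
    moreover have "real (\<alpha> k) \<le> L * real (\<alpha> i)"
      using assms(2)[OF i(2)] \<open>0 < \<alpha> i\<close> i by (simp add: field_simps)
    moreover have "L * real (\<alpha> i) \<le> real (nat \<lceil>L\<rceil>) * real n"
      using \<open>\<alpha> i < n\<close> by (intro mult_mono) linarith+
    ultimately have "real (\<alpha> k) \<le> real (nat \<lceil>L\<rceil> * n)" by simp
    then show ?thesis using k by (intro exI[of _ k]) linarith
  qed
qed

lemma admissible_gap:
  assumes "admissible \<alpha> \<beta>"
  obtains K c :: nat where "\<And>n. \<exists>k. n \<le> \<alpha> k \<and> \<alpha> k \<le> K * n + c" "\<And>n. \<exists>k. n \<le> \<beta> k \<and> \<beta> k \<le> K * n + c"
proof -
  obtain L where L: "strict_mono \<alpha>" "strict_mono \<beta>"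
    "\<And>n. n \<ge> 1 \<Longrightarrow> real (\<alpha> (Suc n)) / real (\<alpha> n) \<le> L"
    "\<And>n. n \<ge> 1 \<Longrightarrow> real (\<beta> (Suc n)) / real (\<beta> n) \<le> L"
    using assms unfolding admissible_def by blast
  obtain K c where 1: "\<And>n. \<exists>k. n \<le> \<alpha> k \<and> \<alpha> k \<le> K * n + c" using gap_index[OF L(1,3)] by blast
  obtain K' c' where 2: "\<And>n. \<exists>k. n \<le> \<beta> k \<and> \<beta> k \<le> K' * n + c'" using gap_index[OF L(2,4)] by blast
  have "K * n + c \<le> max K K' * n + max c c'" "K' * n + c' \<le> max K K' * n + max c c'" for n
    by (intro add_mono mult_right_mono; simp)+
  with 1 2 show ?thesis by (intro that[of "max K K'" "max c c'"]) (meson order_trans)+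
qed

text \<open>For n <= \<alpha> k one has |x|^n <= 1 + |x|^(\<alpha> k); the summand 1 is paid for by
  the bound of index 0, since \<alpha> 0 = 0.\<close>

lemma fill_gaps_decay:
  fixes f :: "real \<Rightarrow> 'a::real_normed_vector"
  assumes gap: "\<And>n. \<exists>k. n \<le> \<alpha> k \<and> \<alpha> k \<le> K * n + c" and "\<alpha> 0 = 0" "\<sigma> \<ge> 0" "\<tau> > 0" "C > 0"
    and b: "\<And>n x. norm (x ^ \<alpha> n *\<^sub>R f x) \<le> C * weight \<tau> \<sigma> (\<alpha> n)"
  obtains u where "wbdd \<sigma> u" "\<And>n x. \<bar>x\<bar> ^ n * norm (f x) \<le> u n"
proof (rule that)
  have "wbdd \<sigma> (weight \<tau> \<sigma>)" using wbdd_weight_dilate[of \<tau> \<sigma> 1] assms by simp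
  then show "wbdd \<sigma> (\<lambda>n. C + C * weight \<tau> \<sigma> (K * n + c))"
    using assms order_trans[OF zero_le_one weight_ge_1[of \<tau> \<sigma>]]
    by (intro wbdd_add wbdd_mult wbdd_const wbdd_affine) auto
  fix n and x :: real
  obtain k where k: "n \<le> \<alpha> k" "\<alpha> k \<le> K * n + c" using gap by blast
  have "\<bar>x\<bar> ^ n \<le> 1 + \<bar>x\<bar> ^ \<alpha> k"
  proof (cases "\<bar>x\<bar> \<le> 1")
    case True
    then show ?thesis using power_le_one[of "\<bar>x\<bar>" n] by (simp add: add_increasing2)
  next
    case False
    then have "\<bar>x\<bar> ^ n \<le> \<bar>x\<bar> ^ \<alpha> k" using k by (intro power_increasing) auto
    then show ?thesis by simp
  qed
  then have "\<bar>x\<bar> ^ n * norm (f x) \<le> (1 + \<bar>x\<bar> ^ \<alpha> k) * norm (f x)" by (intro mult_right_mono) auto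
  also have "\<dots> = norm (x ^ \<alpha> 0 *\<^sub>R f x) + norm (x ^ \<alpha> k *\<^sub>R f x)"
    using assms(2) by (simp add: algebra_simps power_abs)
  also have "\<dots> \<le> C * weight \<tau> \<sigma> (\<alpha> 0) + C * weight \<tau> \<sigma> (\<alpha> k)" by (intro add_mono b)
  also have "\<dots> \<le> C + C * weight \<tau> \<sigma> (K * n + c)"
    using assms k by (auto simp: weight_0 intro!: weight_mono)
  finally show "\<bar>x\<bar> ^ n * norm (f x) \<le> C + C * weight \<tau> \<sigma> (K * n + c)" .
qed

text \<open>Landau interpolation on the half-line starting at x, between order \<beta> 0 = 0, where
  f is bounded by C, and some order \<beta> k >= n.\<close>

lemma fill_gaps_deriv:
  assumes gap: "\<And>n. \<exists>k. n \<le> \<beta> k \<and> \<beta> k \<le> K * n + c" and "\<beta> 0 = 0" "\<sigma> \<ge> 1" "\<tau> > 0" "C > 0"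
    and "smooth f" and b: "\<And>n x. norm (nth_deriv (\<beta> n) f x) \<le> C * weight \<tau> \<sigma> (\<beta> n)"
  obtains v where "wbdd \<sigma> v" "\<And>n x. norm (nth_deriv n f x) \<le> v n"
proof (rule that)
  have w: "0 \<le> weight \<tau> \<sigma> n" for n using weight_ge_1[of \<tau> \<sigma> n] assms by simp
  have l: "0 \<le> landau_const n" for n using landau_const_ge_1[of n] by simp
  have "wbdd \<sigma> (weight \<tau> \<sigma>)" using wbdd_weight_dilate[of \<tau> \<sigma> 1] assms by simp
  then show "wbdd \<sigma> (\<lambda>n. landau_const (K * n + c) * (C + C * weight \<tau> \<sigma> (K * n + c)))"
    using assms w l by (intro wbdd_add wbdd_mult wbdd_const wbdd_affine wbdd_landau_const) auto
  fix n x
  obtain k where k: "n \<le> \<beta> k" "\<beta> k \<le> K * n + c" using gap by blast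
  have "norm (nth_deriv n f (x + 0)) \<le> landau_const (\<beta> k) * (C + C * weight \<tau> \<sigma> (\<beta> k))"
  proof (rule landau_halfline[of "\<lambda>i t. nth_deriv i f (x + t)"])
    fix i t
    have "((\<lambda>t. x + t) has_vector_derivative 1) (at t)" by (auto intro!: derivative_eq_intros)
    from vector_diff_chain_at[OF this smooth_nth_deriv[OF assms(6), of i]]
    show "((\<lambda>t. nth_deriv i f (x + t)) has_vector_derivative nth_deriv (Suc i) f (x + t)) (at t)"
      by (simp add: o_def)
    show "norm (nth_deriv 0 f (x + t)) \<le> C" using b[of 0 "x + t"] assms(2) by (simp add: weight_0)
  qed (use b k in auto)
  also have "\<dots> \<le> landau_const (K * n + c) * (C + C * weight \<tau> \<sigma> (K * n + c))"
    using assms k l w by (intro mult_mono add_mono weight_mono landau_const_mono) auto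
  finally show "norm (nth_deriv n f x) \<le> landau_const (K * n + c) * (C + C * weight \<tau> \<sigma> (K * n + c))" by simp
qed

subsection \<open>Oscillatory integrals\<close>

text \<open>The parameter s covers the Fourier integral (s = -2 pi) and its inverse (s = 2 pi), so
  each estimate is proved once for both.\<close>

definition oscillatory_integral :: "real \<Rightarrow> (real \<Rightarrow> complex) \<Rightarrow> real \<Rightarrow> complex" where
  "oscillatory_integral s f \<xi> = (LINT x|lborel. f x * iexp (s * x * \<xi>))"

lemma fourier_integral_eq_oscillatory: "fourier_integral f = oscillatory_integral (- (2 * pi)) f"
  by (simp add: fun_eq_iff fourier_integral_def oscillatory_integral_def mult_ac)

text \<open>This is the number pi, carried through the estimates as an abstract constant.\<close>

definition cauchy_mass :: real where
  "cauchy_mass = (LINT x|lborel. inverse (1 + x\<^sup>2))"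

lemma integrable_cauchy: "integrable lborel (\<lambda>x::real. inverse (1 + x\<^sup>2))"
  using integrable_inverse_1_plus_square by (simp add: set_integrable_def)

lemma cauchy_mass_nonneg: "0 \<le> cauchy_mass"
  unfolding cauchy_mass_def by (intro integral_nonneg_AE AE_I2) (simp add: add_nonneg_nonneg)

lemma
  fixes f :: "real \<Rightarrow> complex"
  assumes m: "f \<in> borel_measurable borel" and b: "\<And>x. (1 + x\<^sup>2) * norm (f x) \<le> B"
  shows integrable_quadratic_decay: "integrable lborel f"
    and integral_quadratic_decay: "(LINT x|lborel. norm (f x)) \<le> cauchy_mass * B"
proof -
  have le: "norm (f x) \<le> B * inverse (1 + x\<^sup>2)" for x
    using b[of x] by (simp add: field_simps add_pos_nonneg)
  have i: "integrable lborel (\<lambda>x::real. B * inverse (1 + x\<^sup>2))" using integrable_cauchy by simp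
  show f: "integrable lborel f"
    by (rule Bochner_Integration.integrable_bound[OF i]) (use m le in \<open>auto intro!: AE_I2 order_trans[OF le abs_ge_self]\<close>)
  have "(LINT x|lborel. norm (f x)) \<le> (LINT x|lborel. B * inverse (1 + x\<^sup>2))"
    using f i le by (intro integral_mono) auto
  then show "(LINT x|lborel. norm (f x)) \<le> cauchy_mass * B" by (simp add: cauchy_mass_def mult.commute)
qed

lemma integrable_times_iexp:
  assumes "integrable lborel f"
  shows "integrable lborel (\<lambda>x. f x * iexp (s * x * \<xi>))"
proof -
  have "(\<lambda>x. iexp (s * x * \<xi>)) \<in> borel_measurable borel"
    by (intro borel_measurable_continuous_onI continuous_intros)
  then show ?thesis
    using assms by (intro Bochner_Integration.integrable_bound[OF assms]) (auto simp: norm_mult)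
qed

lemma norm_oscillatory_integral_le:
  "norm (oscillatory_integral s f \<xi>) \<le> (LINT x|lborel. norm (f x))"
  unfolding oscillatory_integral_def
  using integral_norm_bound[of lborel "\<lambda>x. f x * iexp (s * x * \<xi>)"] by (simp add: norm_mult)

lemma has_vector_derivative_quadraticI:
  fixes H :: "real \<Rightarrow> 'a::real_normed_vector"
  assumes "\<And>h. norm (H (x + h) - H x - h *\<^sub>R D) \<le> K * h\<^sup>2"
  shows "(H has_vector_derivative D) (at x)"
  unfolding has_vector_derivative_def has_derivative_at
proof (intro conjI bounded_linear_scaleR_left)
  show "((\<lambda>h. norm (H (x + h) - H x - h *\<^sub>R D) / norm h) \<longlongrightarrow> 0) (at 0)"
  proof (rule Lim_null_comparison)
    show "\<forall>\<^sub>F h in at 0. norm (norm (H (x + h) - H x - h *\<^sub>R D) / norm h) \<le> K * \<bar>h\<bar>"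
      unfolding eventually_at_filter
    proof (intro always_eventually allI impI)
      fix h :: real assume "h \<noteq> 0"
      then show "norm (norm (H (x + h) - H x - h *\<^sub>R D) / norm h) \<le> K * \<bar>h\<bar>"
        using assms[of h] by (simp add: divide_le_eq power2_eq_square mult.assoc)
    qed
    show "((\<lambda>h. K * \<bar>h\<bar>) \<longlongrightarrow> 0) (at 0)" by (auto intro!: tendsto_eq_intros)
  qed
qed

text \<open>Differentiation under the integral sign by Taylor expansion: the first-order remainder
  of the exponential is at most (s x h)^2 / 2, so a finite second moment makes the total error
  quadratic in h.\<close>

lemma oscillatory_integral_has_vector_derivative:
  assumes f: "integrable lborel f" and f1: "integrable lborel (\<lambda>x. \<i> * of_real (s * x) * f x)"
    and f2: "integrable lborel (\<lambda>x. of_real x ^ 2 * f x)"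
  shows "(oscillatory_integral s f has_vector_derivative
           oscillatory_integral s (\<lambda>x. \<i> * of_real (s * x) * f x) \<xi>) (at \<xi>)"
proof (rule has_vector_derivative_quadraticI)
  fix h
  note A = integrable_times_iexp[OF f] and B = integrable_times_iexp[OF f1]
  define R where "R x = f x * iexp (s * x * (\<xi> + h)) - f x * iexp (s * x * \<xi>)
    - h *\<^sub>R (\<i> * of_real (s * x) * f x * iexp (s * x * \<xi>))" for x
  have R: "integrable lborel R" unfolding R_def
    by (intro Bochner_Integration.integrable_diff integrable_scaleR_right A B)
  have "oscillatory_integral s f (\<xi> + h) - oscillatory_integral s f \<xi>
      - h *\<^sub>R oscillatory_integral s (\<lambda>x. \<i> * of_real (s * x) * f x) \<xi> = integral\<^sup>L lborel R"
    unfolding oscillatory_integral_def R_def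
    by (simp only: Bochner_Integration.integral_diff[OF Bochner_Integration.integrable_diff[OF A A] integrable_scaleR_right[OF B]]
        Bochner_Integration.integral_diff[OF A A] Bochner_Integration.integral_scaleR_right B)
  also have "norm \<dots> \<le> (LINT x|lborel. norm (R x))" by (rule integral_norm_bound)
  also have "\<dots> \<le> (LINT x|lborel. (s\<^sup>2 * h\<^sup>2 / 2) * norm (of_real x ^ 2 * f x))"
  proof (rule integral_mono)
    fix x
    have "R x = (f x * iexp (s * x * \<xi>)) * (iexp (s * x * h) - (\<Sum>k\<le>1. (\<i> * of_real (s * x * h)) ^ k / fact k))"
      by (simp add: R_def distrib_left exp_add scaleR_conv_of_real algebra_simps)
    then have "norm (R x) = norm (f x) * norm (iexp (s * x * h) - (\<Sum>k\<le>1. (\<i> * of_real (s * x * h)) ^ k / fact k))"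
      by (simp add: norm_mult)
    also have "\<dots> \<le> norm (f x) * (\<bar>s * x * h\<bar> ^ Suc 1 / fact (Suc 1))"
      by (intro mult_left_mono iexp_approx1) simp
    also have "\<dots> = (s\<^sup>2 * h\<^sup>2 / 2) * norm (of_real x ^ 2 * f x)"
      unfolding Suc_1 power2_abs by (simp add: norm_mult norm_power power_mult_distrib)
    finally show "norm (R x) \<le> (s\<^sup>2 * h\<^sup>2 / 2) * norm (of_real x ^ 2 * f x)" .
  qed (use R f2 in auto)
  also have "\<dots> = (s\<^sup>2 / 2 * (LINT x|lborel. norm (of_real x ^ 2 * f x))) * h\<^sup>2" by simp
  finally show "norm (oscillatory_integral s f (\<xi> + h) - oscillatory_integral s f \<xi>
      - h *\<^sub>R oscillatory_integral s (\<lambda>x. \<i> * of_real (s * x) * f x) \<xi>)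
      \<le> (s\<^sup>2 / 2 * (LINT x|lborel. norm (of_real x ^ 2 * f x))) * h\<^sup>2" .
qed

text \<open>The n-th derivative is the transform of (i s x)^n f. Its L1 norm costs the moments n and
  n + 2 through the weight 1 + x^2. Differentiability also uses the second moment of that function,
  hence moment n + 4 of f.\<close>

lemma
  fixes f :: "real \<Rightarrow> complex"
  assumes m: "f \<in> borel_measurable borel" and u: "\<And>n x. \<bar>x\<bar> ^ n * norm (f x) \<le> u n"
  shows smooth_oscillatory_integral: "smooth (oscillatory_integral s f)"
    and norm_deriv_oscillatory_integral_le:
      "norm (nth_deriv n (oscillatory_integral s f) \<xi>) \<le> cauchy_mass * (\<bar>s\<bar> ^ n * (u n + u (n + 2)))"
proof -
  define g where "g n x = (\<i> * of_real (s * x)) ^ n * f x" for n x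
  have gm: "g n \<in> borel_measurable borel" for n
    unfolding g_def using m by (intro borel_measurable_times borel_measurable_power borel_measurable_continuous_onI[of "\<lambda>x. \<i> * of_real (s * x)"] continuous_intros)
  have mom: "(1 + x\<^sup>2) * (\<bar>x\<bar> ^ n * norm (f x)) \<le> u n + u (n + 2)" for n x
  proof -
    have "(1 + x\<^sup>2) * (\<bar>x\<bar> ^ n * norm (f x)) = \<bar>x\<bar> ^ n * norm (f x) + \<bar>x\<bar> ^ (n + 2) * norm (f x)"
      by (simp add: power_add algebra_simps del: add_2_eq_Suc')
    also have "\<dots> \<le> u n + u (n + 2)" by (intro add_mono u)
    finally show ?thesis .
  qed
  have gb: "(1 + x\<^sup>2) * norm (g n x) \<le> \<bar>s\<bar> ^ n * (u n + u (n + 2))" for n x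
  proof -
    have "(1 + x\<^sup>2) * norm (g n x) = \<bar>s\<bar> ^ n * ((1 + x\<^sup>2) * (\<bar>x\<bar> ^ n * norm (f x)))"
      by (simp add: g_def norm_mult norm_power abs_mult power_mult_distrib)
    also have "\<dots> \<le> \<bar>s\<bar> ^ n * (u n + u (n + 2))" by (intro mult_left_mono mom) auto
    finally show ?thesis .
  qed
  have gi: "integrable lborel (g n)" for n by (rule integrable_quadratic_decay[OF gm gb])
  have x2: "integrable lborel (\<lambda>x. of_real x ^ 2 * g n x)" for n
  proof (rule integrable_quadratic_decay)
    show "(\<lambda>x. of_real x ^ 2 * g n x) \<in> borel_measurable borel" using gm by simp
    fix x :: real
    have "(1 + x\<^sup>2) * norm (of_real x ^ 2 * g n x) = \<bar>s\<bar> ^ n * ((1 + x\<^sup>2) * (\<bar>x\<bar> ^ (n + 2) * norm (f x)))"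
      by (simp add: g_def norm_mult norm_power abs_mult power_mult_distrib power_add) (simp add: power2_eq_square)
    also have "\<dots> \<le> \<bar>s\<bar> ^ n * (u (n + 2) + u (n + 2 + 2))" by (intro mult_left_mono mom) auto
    finally show "(1 + x\<^sup>2) * norm (of_real x ^ 2 * g n x) \<le> \<bar>s\<bar> ^ n * (u (n + 2) + u (n + 2 + 2))" .
  qed
  have Suc: "(\<lambda>x. \<i> * of_real (s * x) * g n x) = g (Suc n)" for n by (simp add: fun_eq_iff g_def mult_ac)
  have d: "(oscillatory_integral s (g n) has_vector_derivative oscillatory_integral s (g (Suc n)) \<xi>) (at \<xi>)" for n \<xi>
    using oscillatory_integral_has_vector_derivative[of "g n" s \<xi>] gi x2 by (simp only: Suc)
  have g0: "g 0 = f" by (simp add: g_def fun_eq_iff)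
  show "smooth (oscillatory_integral s f)"
    using smoothI[of "\<lambda>n. oscillatory_integral s (g n)", OF d] by (simp only: g0)
  have "nth_deriv n (oscillatory_integral s f) = oscillatory_integral s (g n)"
    using nth_deriv_eqI[of "\<lambda>n. oscillatory_integral s (g n)", OF d] by (simp only: g0)
  then show "norm (nth_deriv n (oscillatory_integral s f) \<xi>) \<le> cauchy_mass * (\<bar>s\<bar> ^ n * (u n + u (n + 2)))"
    using norm_oscillatory_integral_le[of s "g n" \<xi>] integral_quadratic_decay[OF gm gb, of n] by simp
qed

text \<open>Integration by parts over the whole line; the quadratic decay supplies both
  integrability and vanishing boundary terms.\<close>

lemma oscillatory_integral_deriv:
  assumes d: "\<And>x. (f has_vector_derivative f' x) (at x)" and c: "continuous_on UNIV f'"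
    and b: "\<And>x. (1 + x\<^sup>2) * norm (f x) \<le> B" and b': "\<And>x. (1 + x\<^sup>2) * norm (f' x) \<le> B'"
  shows "oscillatory_integral s f' \<xi> = - \<i> * of_real (s * \<xi>) * oscillatory_integral s f \<xi>"
proof -
  define e where "e x = iexp (s * x * \<xi>)" for x
  have de: "(e has_vector_derivative \<i> * of_real (s * \<xi>) * e x) (at x)" for x
  proof -
    have "((\<lambda>x. s * x * \<xi>) has_vector_derivative s * \<xi>) (at x)"
      by (auto intro!: derivative_eq_intros)
    from vector_diff_chain_at[OF this has_vector_derivative_iexp] show ?thesis
      unfolding e_def o_def by (simp add: scaleR_conv_of_real mult_ac)
  qed
  have cf: "continuous_on UNIV f"
    using d has_vector_derivative_continuous by (blast intro: continuous_at_imp_continuous_on)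
  have ce: "continuous_on UNIV e"
    using de has_vector_derivative_continuous by (blast intro: continuous_at_imp_continuous_on)
  have fi: "integrable lborel f"
    by (rule integrable_quadratic_decay[OF borel_measurable_continuous_onI[OF cf] b])
  have fi': "integrable lborel f'"
    by (rule integrable_quadratic_decay[OF borel_measurable_continuous_onI[OF c] b'])
  have ei: "integrable lborel (\<lambda>x. f' x * e x)" "integrable lborel (\<lambda>x. f x * e x)"
    unfolding e_def by (intro integrable_times_iexp fi fi')+
  \<comment> \<open>\<open>D\<close> is the derivative of \<open>f x * e x\<close>, which vanishes
    at both ends, so its integral is 0; splitting that integral gives the identity.\<close>
  define D where "D x = f' x * e x + (\<i> * of_real (s * \<xi>)) * (f x * e x)" for x
  have Di: "integrable lborel D" unfolding D_def using ei by simp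
  have le: "norm (f x * e x) \<le> B / (1 + x\<^sup>2)" for x
    using b[of x] by (simp add: norm_mult e_def field_simps add_pos_nonneg)
  have "(LBINT x=-\<infinity>..\<infinity>. D x) = 0 - 0"
  proof (rule interval_integral_FTC_integrable[where F = "\<lambda>x. f x * e x"])
    show "((\<lambda>x. f x * e x) has_vector_derivative D x) (at x)" for x
      using has_vector_derivative_mult[OF d de, of x] by (simp add: D_def algebra_simps)
    have "continuous_on UNIV D" unfolding D_def by (intro continuous_intros c cf ce)
    then show "isCont D x" for x by (simp add: continuous_on_eq_continuous_at)
    show "set_integrable lborel (einterval (- \<infinity>) \<infinity>) D" using Di by (simp add: set_integrable_def)
    show "(((\<lambda>x. f x * e x) \<circ> real_of_ereal) \<longlongrightarrow> 0) (at_right (- \<infinity>))"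
      unfolding ereal_tendsto_simps
      by (rule Lim_null_comparison[OF always_eventually[OF allI[OF le]]]) real_asymp
    show "(((\<lambda>x. f x * e x) \<circ> real_of_ereal) \<longlongrightarrow> 0) (at_left \<infinity>)"
      unfolding ereal_tendsto_simps
      by (rule Lim_null_comparison[OF always_eventually[OF allI[OF le]]]) real_asymp
  qed simp
  then have "integral\<^sup>L lborel D = 0"
    by (simp add: interval_lebesgue_integral_def set_lebesgue_integral_def)
  moreover have "integral\<^sup>L lborel D = oscillatory_integral s f' \<xi> + (\<i> * of_real (s * \<xi>)) * oscillatory_integral s f \<xi>"
    unfolding D_def oscillatory_integral_def e_def[symmetric]
    by (subst Bochner_Integration.integral_add) (use ei in auto)
  ultimately show ?thesis by (simp add: eq_neg_iff_add_eq_0)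
qed

lemma oscillatory_integral_decay:
  assumes "smooth f" "\<And>n x. (1 + x\<^sup>2) * norm (nth_deriv n f x) \<le> w n" "1 \<le> \<bar>s\<bar>"
  shows "\<bar>\<xi>\<bar> ^ n * norm (oscillatory_integral s f \<xi>) \<le> cauchy_mass * w n"
proof -
  note d = smooth_nth_deriv[OF assms(1)]
  have c: "continuous_on UNIV (nth_deriv n f)" for n
    using d has_vector_derivative_continuous by (blast intro: continuous_at_imp_continuous_on)
  have eq: "oscillatory_integral s (nth_deriv n f) \<xi> = (- \<i> * of_real (s * \<xi>)) ^ n * oscillatory_integral s f \<xi>" for n
  proof (induction n)
    case (Suc n)
    then show ?case by (subst oscillatory_integral_deriv[OF d c assms(2) assms(2)]) simp
  qed (simp add: nth_deriv_def)
  have "\<bar>\<xi>\<bar> ^ n * norm (oscillatory_integral s f \<xi>) \<le> \<bar>s\<bar> ^ n * (\<bar>\<xi>\<bar> ^ n * norm (oscillatory_integral s f \<xi>))"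
    using mult_right_mono[OF one_le_power[OF assms(3), of n], of "\<bar>\<xi>\<bar> ^ n * norm (oscillatory_integral s f \<xi>)"] by simp
  also have "\<dots> = norm (oscillatory_integral s (nth_deriv n f) \<xi>)"
    by (simp add: eq norm_mult norm_power abs_mult power_mult_distrib)
  also have "\<dots> \<le> (LINT x|lborel. norm (nth_deriv n f x))" by (rule norm_oscillatory_integral_le)
  also have "\<dots> \<le> cauchy_mass * w n"
    by (rule integral_quadratic_decay[OF borel_measurable_continuous_onI[OF c] assms(2)])
  finally show ?thesis .
qed

subsection \<open>Fourier inversion\<close>

text \<open>Complex a and b let one family contain both the modulated Gaussians tested against the
  transform (b imaginary) and the normal densities (b real).\<close>

definition gaussian :: "complex \<Rightarrow> complex \<Rightarrow> real \<Rightarrow> real \<Rightarrow> complex" where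
  "gaussian a b c y = exp (a + b * of_real y - of_real c * (of_real y)\<^sup>2)"

text \<open>Since |y| <= exp |y|, the power only adds a linear term to the exponent, and completing
  the square bounds the result.\<close>

lemma gaussian_power_bounded:
  assumes "c > 0"
  obtains B where "\<And>y. \<bar>y\<bar> ^ k * norm (gaussian a b c y) \<le> B"
proof (rule that)
  fix y :: real
  define r where "r = \<bar>Re b\<bar> + real k"
  have "\<bar>y\<bar> ^ k \<le> exp \<bar>y\<bar> ^ k" using exp_ge_add_one_self[of "\<bar>y\<bar>"] by (intro power_mono) linarith+
  also have "\<dots> = exp (real k * \<bar>y\<bar>)" by (simp add: exp_of_nat_mult)
  finally have "\<bar>y\<bar> ^ k * norm (gaussian a b c y) \<le> exp (real k * \<bar>y\<bar>) * exp (Re a + Re b * y - c * y\<^sup>2)"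
    by (simp add: gaussian_def norm_exp_eq_Re flip: of_real_power)
  also have "\<dots> = exp (real k * \<bar>y\<bar> + (Re a + Re b * y - c * y\<^sup>2))" by (simp add: exp_add)
  also have "\<dots> \<le> exp (Re a + r\<^sup>2 / (4 * c))"
    unfolding exp_le_cancel_iff
  proof -
    have "Re b * y \<le> \<bar>Re b\<bar> * \<bar>y\<bar>" by (simp flip: abs_mult)
    then have "real k * \<bar>y\<bar> + Re b * y \<le> r * \<bar>y\<bar>" by (simp add: r_def algebra_simps)
    moreover have "r * \<bar>y\<bar> - c * y\<^sup>2 = r\<^sup>2 / (4 * c) - c * (\<bar>y\<bar> - r / (2 * c))\<^sup>2"
      using assms by (simp add: field_simps power2_eq_square)
    moreover have "0 \<le> c * (\<bar>y\<bar> - r / (2 * c))\<^sup>2" using assms by simp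
    ultimately show "real k * \<bar>y\<bar> + (Re a + Re b * y - c * y\<^sup>2) \<le> Re a + r\<^sup>2 / (4 * c)" by linarith
  qed
  finally show "\<bar>y\<bar> ^ k * norm (gaussian a b c y) \<le> exp (Re a + r\<^sup>2 / (4 * c))"
    unfolding r_def .
qed

lemma poly_gaussian_bounded:
  assumes "c > 0"
  shows "bounded (range (\<lambda>y. poly p (of_real y) * gaussian a b c y))"
proof -
  have "\<forall>k. \<exists>B. \<forall>y. \<bar>y\<bar> ^ k * norm (gaussian a b c y) \<le> B"
    using gaussian_power_bounded[OF assms] by metis
  then obtain B where B: "\<And>k y. \<bar>y\<bar> ^ k * norm (gaussian a b c y) \<le> B k" by metis
  have "norm (poly p (of_real y) * gaussian a b c y) \<le> (\<Sum>i\<le>degree p. norm (coeff p i) * B i)" for y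
  proof -
    have "poly p (of_real y) * gaussian a b c y = (\<Sum>i\<le>degree p. coeff p i * (of_real y ^ i * gaussian a b c y))"
      by (simp add: poly_altdef sum_distrib_right mult.assoc)
    also have "norm \<dots> \<le> (\<Sum>i\<le>degree p. norm (coeff p i) * (\<bar>y\<bar> ^ i * norm (gaussian a b c y)))"
      by (rule order_trans[OF norm_sum]) (simp add: norm_mult norm_power)
    also have "\<dots> \<le> (\<Sum>i\<le>degree p. norm (coeff p i) * B i)"
      by (intro sum_mono mult_left_mono B) auto
    finally show ?thesis .
  qed
  then show ?thesis unfolding bounded_iff by blast
qed

lemma gaussian_schwartz:
  assumes "c > 0"
  shows "gaussian a b c \<in> schwartz"
proof -
  \<comment> \<open>Differentiating p times the Gaussian gives (p' + (b - 2 c y) p) times the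
    Gaussian; \<open>P\<close> iterates this map on polynomials.\<close>
  define P where "P n = ((\<lambda>p. pderiv p + [:b, - 2 * of_real c:] * p) ^^ n) 1" for n
  define F where "F n y = poly (P n) (of_real y) * gaussian a b c y" for n y
  have d: "(F n has_vector_derivative F (Suc n) y) (at y)" for n y
  proof -
    have "((\<lambda>z. poly (P n) z * exp (a + b * z - of_real c * z\<^sup>2)) has_field_derivative
        poly (P (Suc n)) (of_real y) * exp (a + b * of_real y - of_real c * (of_real y)\<^sup>2)) (at (of_real y))"
      by (auto intro!: derivative_eq_intros simp: P_def algebra_simps)
    from has_vector_derivative_real_field[OF this] show ?thesis
      by (simp add: F_def[abs_def] gaussian_def)
  qed
  have F0: "F 0 = gaussian a b c" by (simp add: F_def P_def fun_eq_iff)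
  have "y ^ \<alpha> *\<^sub>R F n y = poly (monom 1 \<alpha> * P n) (of_real y) * gaussian a b c y" for \<alpha> n y
    by (simp add: F_def poly_monom scaleR_conv_of_real)
  then have "bounded (range (\<lambda>y. y ^ \<alpha> *\<^sub>R F n y))" for \<alpha> n
    by (simp only: poly_gaussian_bounded[OF assms])
  then show ?thesis
    using smoothI[of F, OF d] nth_deriv_eqI[of F, OF d] by (simp add: schwartz_def F0)
qed

text \<open>The normalising factor enters the exponent as a logarithm, so
  \<open>gaussian_schwartz\<close> makes normal densities available as test functions.\<close>

lemma normal_density_eq_gaussian:
  assumes "s > 0"
  shows "of_real (normal_density x s y) =
    gaussian (of_real (ln (1 / sqrt (2 * pi * s\<^sup>2)) - x\<^sup>2 / (2 * s\<^sup>2))) (of_real (x / s\<^sup>2)) (1 / (2 * s\<^sup>2)) y"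
proof -
  have "normal_density x s y = exp (ln (1 / sqrt (2 * pi * s\<^sup>2)) + - (y - x)\<^sup>2 / (2 * s\<^sup>2))"
    using assms unfolding normal_density_def exp_add by (subst exp_ln) auto
  also have "ln (1 / sqrt (2 * pi * s\<^sup>2)) + - (y - x)\<^sup>2 / (2 * s\<^sup>2)
      = (ln (1 / sqrt (2 * pi * s\<^sup>2)) - x\<^sup>2 / (2 * s\<^sup>2)) + x / s\<^sup>2 * y - 1 / (2 * s\<^sup>2) * y\<^sup>2"
    using assms by (simp add: field_simps power2_eq_square)
  finally show ?thesis by (simp add: gaussian_def flip: exp_of_real)
qed

text \<open>The substitution z = w \<xi> with w = 2 pi s reduces this to the characteristic function
  of the standard normal distribution at t = (x - y) / s, because t w = 2 pi (x - y).\<close>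

lemma fourier_integral_gaussian:
  assumes "s > 0"
  shows "fourier_integral (gaussian 0 (2 * of_real pi * \<i> * of_real x) ((2 * pi * s)\<^sup>2 / 2)) y
    = of_real (normal_density x s y)"
proof -
  define t where "t = (x - y) / s"
  define w where "w = 2 * pi * s"
  have w: "w > 0" using assms by (simp add: w_def)
  have "char std_normal_distribution t = (CLINT z|lborel. std_normal_density z *\<^sub>R iexp (t * z))"
    unfolding char_def by (subst integral_density) auto
  also have "\<dots> = \<bar>w\<bar> *\<^sub>R (CLINT \<xi>|lborel. std_normal_density (0 + w * \<xi>) *\<^sub>R iexp (t * (0 + w * \<xi>)))"
    using w by (intro lborel_integral_real_affine) simp
  finally have ch: "w *\<^sub>R (CLINT \<xi>|lborel. std_normal_density (w * \<xi>) *\<^sub>R iexp (t * (w * \<xi>))) = of_real (exp (- t\<^sup>2 / 2))"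
    using w by (simp add: char_std_normal_distribution)
  have "gaussian 0 (2 * of_real pi * \<i> * of_real x) (w\<^sup>2 / 2) \<xi> * exp (- (2 * of_real pi * \<i> * of_real \<xi> * of_real y))
      = sqrt (2 * pi) *\<^sub>R (std_normal_density (w * \<xi>) *\<^sub>R iexp (t * (w * \<xi>)))" for \<xi>
  proof -
    have "gaussian 0 (2 * of_real pi * \<i> * of_real x) (w\<^sup>2 / 2) \<xi> * exp (- (2 * of_real pi * \<i> * of_real \<xi> * of_real y))
        = exp (of_real (- (w * \<xi>)\<^sup>2 / 2) + \<i> * of_real (2 * pi * (x - y) * \<xi>))"
      unfolding gaussian_def exp_add[symmetric]
      by (rule arg_cong[of _ _ exp]) (simp add: algebra_simps power_mult_distrib)
    also have "2 * pi * (x - y) * \<xi> = t * (w * \<xi>)" using assms by (simp add: t_def w_def)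
    also have "exp (of_real (- (w * \<xi>)\<^sup>2 / 2) + \<i> * of_real (t * (w * \<xi>))) =
        of_real (exp (- (w * \<xi>)\<^sup>2 / 2)) * iexp (t * (w * \<xi>))"
      unfolding exp_add exp_of_real by simp
    also have "exp (- (w * \<xi>)\<^sup>2 / 2) = sqrt (2 * pi) * std_normal_density (w * \<xi>)"
      by (simp add: std_normal_density_def)
    finally show ?thesis by (simp add: scaleR_conv_of_real mult.assoc)
  qed
  then have "fourier_integral (gaussian 0 (2 * of_real pi * \<i> * of_real x) (w\<^sup>2 / 2)) y
      = sqrt (2 * pi) *\<^sub>R (CLINT \<xi>|lborel. std_normal_density (w * \<xi>) *\<^sub>R iexp (t * (w * \<xi>)))"
    unfolding fourier_integral_def scaleR_conv_of_real[of "sqrt (2 * pi)"] by (simp only: integral_mult_right_zero)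
  also have "\<dots> = (sqrt (2 * pi) / w) *\<^sub>R of_real (exp (- t\<^sup>2 / 2))"
    unfolding ch[symmetric] using w by simp
  also have "\<dots> = of_real (normal_density x s y)"
  proof -
    have "sqrt (2 * pi) / w = 1 / (s * sqrt (2 * pi))"
      using assms by (simp add: w_def field_simps)
    moreover have "- t\<^sup>2 / 2 = - (y - x)\<^sup>2 / (2 * s\<^sup>2)"
      using assms by (simp add: t_def power_divide power2_commute)
    ultimately show ?thesis using assms
      by (simp add: normal_density_def scaleR_conv_of_real real_sqrt_mult mult.commute)
  qed
  finally show ?thesis unfolding w_def .
qed

lemma normal_density_rescale:
  assumes "N > 0"
  shows "normal_density x (1 / N) y = N * exp (- ((y - x)\<^sup>2 / 2) * (N\<^sup>2 - 1)) * normal_density x 1 y"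
proof -
  have "exp (- ((y - x)\<^sup>2 / 2) * (N\<^sup>2 - 1)) * exp (- (y - x)\<^sup>2 / 2) = exp (- (y - x)\<^sup>2 * N\<^sup>2 / 2)"
    unfolding exp_add[symmetric] by (rule arg_cong[of _ _ exp]) (simp add: algebra_simps)
  then show ?thesis using assms
    by (simp add: normal_density_def real_sqrt_mult real_sqrt_divide power_divide mult.assoc)
qed

text \<open>As f may grow, its tails cannot be bounded by a supremum. Beyond distance d the narrow
  density is instead compared with the density of deviation 1, against which f is integrable; near x
  continuity suffices.\<close>

lemma normal_density_approximate_identity:
  fixes f :: "real \<Rightarrow> complex"
  assumes c: "isCont f x" and i: "\<And>s. s > 0 \<Longrightarrow> integrable lborel (\<lambda>y. f y * of_real (normal_density x s y))"
  shows "(\<lambda>n. LINT y|lborel. f y * of_real (normal_density x (1 / real (Suc n)) y)) \<longlonglongrightarrow> f x"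
proof (rule LIMSEQ_I)
  fix e :: real assume e: "e > 0"
  obtain d where d: "d > 0" "\<And>y. \<bar>y - x\<bar> < d \<Longrightarrow> norm (f y - f x) < e / 2"
    using c e unfolding continuous_at_eps_delta dist_norm by (metis half_gt_zero real_norm_def)
  \<comment> \<open>The factor of \<open>normal_density_rescale\<close> with N = n + 1 at distance
    d; it decreases with the distance and tends to 0 as n grows.\<close>
  define k where "k n = real (Suc n) * exp (- (d\<^sup>2 / 2) * ((real (Suc n))\<^sup>2 - 1))" for n
  define g where "g s y = (f y - f x) * of_real (normal_density x s y)" for s y
  have ni: "integrable lborel (\<lambda>y. f x * of_real (normal_density x s y))" if "s > 0" for s
    using integrable_normal_density[OF that] by simp
  have g: "integrable lborel (g s)" if "s > 0" for s
    unfolding g_def left_diff_distrib by (intro Bochner_Integration.integrable_diff i ni that)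
  define D where "D = (LINT y|lborel. norm (g 1 y))"
  have main: "norm ((LINT y|lborel. f y * of_real (normal_density x (1 / real (Suc n)) y)) - f x) \<le> e / 2 + k n * D" for n
  proof -
    define s where "s = 1 / real (Suc n)"
    have s: "s > 0" by (simp add: s_def)
    have "(LINT y|lborel. f x * of_real (normal_density x s y)) = f x"
      using s by (simp add: integral_normal_density)
    then have "(LINT y|lborel. f y * of_real (normal_density x s y)) - f x = integral\<^sup>L lborel (g s)"
      unfolding g_def left_diff_distrib
      by (subst Bochner_Integration.integral_diff[OF i[OF s] ni[OF s]]) simp
    also have "norm \<dots> \<le> (LINT y|lborel. norm (g s y))" by (rule integral_norm_bound)
    also have "\<dots> \<le> (LINT y|lborel. e / 2 * normal_density x s y + k n * norm (g 1 y))"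
    proof (rule integral_mono)
      show "integrable lborel (\<lambda>y. e / 2 * normal_density x s y + k n * norm (g 1 y))"
        using g[of 1] s by (intro Bochner_Integration.integrable_add integrable_mult_right integrable_norm) auto
      fix y
      show "norm (g s y) \<le> e / 2 * normal_density x s y + k n * norm (g 1 y)"
      proof (cases "\<bar>y - x\<bar> < d")
        case True
        have "norm (g s y) = norm (f y - f x) * normal_density x s y" by (simp add: g_def norm_mult)
        also have "\<dots> \<le> e / 2 * normal_density x s y" using d(2)[OF True] by (intro mult_right_mono) auto
        finally show ?thesis by (simp add: k_def add_increasing2)
      next
        case False
        have "d\<^sup>2 \<le> (y - x)\<^sup>2" using False d(1) power_mono[of d "\<bar>y - x\<bar>" 2] by simp
        then have "exp (- ((y - x)\<^sup>2 / 2) * ((real (Suc n))\<^sup>2 - 1)) \<le> exp (- (d\<^sup>2 / 2) * ((real (Suc n))\<^sup>2 - 1))"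
          unfolding exp_le_cancel_iff by (intro mult_right_mono) (auto simp: power2_eq_square algebra_simps)
        then have "normal_density x s y \<le> k n * normal_density x 1 y"
          unfolding s_def k_def by (subst normal_density_rescale) (auto intro!: mult_right_mono)
        then have "norm (f y - f x) * normal_density x s y \<le> norm (f y - f x) * (k n * normal_density x 1 y)"
          by (intro mult_left_mono) auto
        then have "norm (g s y) \<le> k n * norm (g 1 y)" by (simp add: g_def norm_mult mult_ac)
        then show ?thesis using e by (simp add: add_increasing)
      qed
    qed (use g s in auto)
    also have "\<dots> = e / 2 + k n * D"
      using g[of 1] s by (simp add: D_def integral_normal_density integrable_normal_density)
    finally show ?thesis by (simp add: s_def)
  qed
  have "k \<longlonglongrightarrow> 0" unfolding k_def using d(1) by real_asymp
  then have "(\<lambda>n. k n * D) \<longlonglongrightarrow> 0" by (rule tendsto_mult_left_zero)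
  then obtain N where "\<And>n. n \<ge> N \<Longrightarrow> \<bar>k n * D\<bar> < e / 2"
    using LIMSEQ_D[of "\<lambda>n. k n * D" 0 "e / 2"] e by auto
  then have "\<And>n. n \<ge> N \<Longrightarrow> norm ((LINT y|lborel. f y * of_real (normal_density x (1 / real (Suc n)) y)) - f x) < e"
    using main by (smt (verit) field_sum_of_halves)
  then show "\<exists>N. \<forall>n\<ge>N. norm ((LINT y|lborel. f y * of_real (normal_density x (1 / real (Suc n)) y)) - f x) < e"
    by blast
qed

text \<open>
  Testing \<open>g\<close> against \<open>\<xi> \<mapsto> exp (2 \<pi> \<i> x \<xi> - (2 \<pi> s \<xi>)^2 / 2)\<close> turns the right-hand side into the mean
  of \<open>f\<close> with respect to the normal density of mean \<open>x\<close> and deviation \<open>s\<close>; then \<open>s\<close> tends to \<open>0\<close>.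
  Only tempered growth of \<open>f\<close> is available here.
\<close>

lemma fourier_inversion:
  assumes ft: "has_fourier_transform f g" and c: "continuous_on UNIV f" and g: "integrable lborel g"
  shows "f = oscillatory_integral (2 * pi) g"
proof
  fix x
  define \<psi> where "\<psi> s = gaussian 0 (2 * of_real pi * \<i> * of_real x) ((2 * pi * s)\<^sup>2 / 2)" for s
  have "(\<lambda>n. LINT y|lborel. f y * of_real (normal_density x (1 / real (Suc n)) y)) \<longlonglongrightarrow> f x"
  proof (rule normal_density_approximate_identity)
    show "isCont f x" using c by (simp add: continuous_on_eq_continuous_at)
    fix s :: real assume "s > 0"
    then have "(\<lambda>y. of_real (normal_density x s y)) \<in> schwartz"
      by (simp add: normal_density_eq_gaussian gaussian_schwartz)
    then show "integrable lborel (\<lambda>y. f y * of_real (normal_density x s y))"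
      using ft unfolding has_fourier_transform_def tempered_def by (elim conjE) (erule bspec)
  qed
  moreover have "(LINT y|lborel. f y * of_real (normal_density x (1 / real (Suc n)) y))
      = (LINT \<xi>|lborel. g \<xi> * \<psi> (1 / real (Suc n)) \<xi>)" for n
  proof -
    have "\<psi> (1 / real (Suc n)) \<in> schwartz" unfolding \<psi>_def by (rule gaussian_schwartz) simp
    moreover have "fourier_integral (\<psi> (1 / real (Suc n))) y = of_real (normal_density x (1 / real (Suc n)) y)" for y
      unfolding \<psi>_def by (rule fourier_integral_gaussian) simp
    ultimately show ?thesis using ft unfolding has_fourier_transform_def by simp
  qed
  moreover have "(\<lambda>n. LINT \<xi>|lborel. g \<xi> * \<psi> (1 / real (Suc n)) \<xi>) \<longlonglongrightarrow> oscillatory_integral (2 * pi) g x"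
    unfolding oscillatory_integral_def
  \<comment> \<open>The Gaussians have modulus at most 1 uniformly in s, so |g| dominates.\<close>
  proof (rule integral_dominated_convergence[where w = "\<lambda>\<xi>. norm (g \<xi>)"])
    have m[measurable]: "g \<in> borel_measurable borel" using g by auto
    show "(\<lambda>\<xi>. g \<xi> * iexp (2 * pi * \<xi> * x)) \<in> borel_measurable lborel"
      using integrable_times_iexp[OF g] by (rule borel_measurable_integrable)
    show "(\<lambda>\<xi>. g \<xi> * \<psi> (1 / real (Suc n)) \<xi>) \<in> borel_measurable lborel" for n
      unfolding \<psi>_def gaussian_def by (intro borel_measurable_times) (auto intro!: borel_measurable_continuous_onI continuous_intros)
    show "AE \<xi> in lborel. norm (g \<xi> * \<psi> (1 / real (Suc n)) \<xi>) \<le> norm (g \<xi>)" for n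
    proof (rule AE_I2)
      fix \<xi>
      have "norm (\<psi> (1 / real (Suc n)) \<xi>) \<le> 1"
        by (simp add: \<psi>_def gaussian_def norm_exp_eq_Re flip: of_real_power)
      then show "norm (g \<xi> * \<psi> (1 / real (Suc n)) \<xi>) \<le> norm (g \<xi>)"
        by (simp add: norm_mult mult_left_le)
    qed
    show "AE \<xi> in lborel. (\<lambda>n. g \<xi> * \<psi> (1 / real (Suc n)) \<xi>) \<longlonglongrightarrow> g \<xi> * iexp (2 * pi * \<xi> * x)"
    proof (rule AE_I2)
      fix \<xi>
      have "(\<lambda>n. (2 * pi * (1 / real (Suc n)))\<^sup>2 / 2) \<longlonglongrightarrow> 0" by real_asymp
      then have "(\<lambda>n. exp (0 + 2 * of_real pi * \<i> * of_real x * of_real \<xi>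
          - of_real ((2 * pi * (1 / real (Suc n)))\<^sup>2 / 2) * (of_real \<xi>)\<^sup>2))
        \<longlonglongrightarrow> exp (0 + 2 * of_real pi * \<i> * of_real x * of_real \<xi> - of_real 0 * (of_real \<xi>)\<^sup>2 :: complex)"
        by (intro tendsto_intros)
      then have "(\<lambda>n. \<psi> (1 / real (Suc n)) \<xi>) \<longlonglongrightarrow> iexp (2 * pi * \<xi> * x)"
        by (simp add: \<psi>_def gaussian_def mult_ac)
      then show "(\<lambda>n. g \<xi> * \<psi> (1 / real (Suc n)) \<xi>) \<longlonglongrightarrow> g \<xi> * iexp (2 * pi * \<xi> * x)"
        by (rule tendsto_mult_left)
    qed
  qed (use g in auto)
  ultimately show "f x = oscillatory_integral (2 * pi) g x"
    using LIMSEQ_unique by simp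
qed

subsection \<open>The characterisations\<close>

text \<open>A single sequence serves all three bounds: the mixed seminorms with powers 0 and 2 give
  the factor 1 + x^2, which later makes every derivative integrable.\<close>

lemma gelfand_shilovD:
  assumes "f \<in> gelfand_shilov \<sigma>"
  obtains w where "smooth f" "wbdd \<sigma> w" "\<And>n x. \<bar>x\<bar> ^ n * norm (f x) \<le> w n"
    "\<And>n x. norm (nth_deriv n f x) \<le> w n" "\<And>n x. (1 + x\<^sup>2) * norm (nth_deriv n f x) \<le> w n"
proof -
  obtain \<tau> C where sm: "smooth f" and \<tau>: "\<tau> > 0" and C: "C > 0"
    and b: "\<And>n j x. norm (x ^ n *\<^sub>R nth_deriv j f x) \<le> C * weight \<tau> \<sigma> n * weight \<tau> \<sigma> j"
    using assms unfolding gelfand_shilov_def by blast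
  define K where "K = C * (1 + weight \<tau> \<sigma> 2)"
  have w: "1 \<le> weight \<tau> \<sigma> n" for n using weight_ge_1 \<tau> by simp
  have K: "K > 0" "C \<le> K" using C w[of 2] by (auto simp: K_def)
  have q: "(1 + x\<^sup>2) * norm (nth_deriv n f x) \<le> K * weight \<tau> \<sigma> n" for n x
    using b[of x 0 n] b[of x 2 n] by (simp add: K_def algebra_simps weight_0)
  show ?thesis
  proof (rule that[OF sm])
    show "wbdd \<sigma> (\<lambda>n. K * weight \<tau> \<sigma> n)" unfolding wbdd_def using \<tau> K by blast
    show "\<bar>x\<bar> ^ n * norm (f x) \<le> K * weight \<tau> \<sigma> n" for n x
    proof -
      have "\<bar>x\<bar> ^ n * norm (f x) \<le> C * weight \<tau> \<sigma> n"
        using b[of x n 0] by (simp add: weight_0 nth_deriv_def power_abs)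
      also have "\<dots> \<le> K * weight \<tau> \<sigma> n" using K w[of n] by (intro mult_right_mono) auto
      finally show ?thesis .
    qed
    show "norm (nth_deriv n f x) \<le> K * weight \<tau> \<sigma> n" for n x
      using q[of x n] mult_right_mono[of 1 "1 + x\<^sup>2" "norm (nth_deriv n f x)"] by simp
  qed (rule q)
qed

lemma smooth_continuous: "smooth f \<Longrightarrow> continuous_on UNIV f"
  using smooth_nth_deriv[of f 0] has_vector_derivative_continuous
  by (fastforce simp: nth_deriv_def intro: continuous_at_imp_continuous_on)

lemma gelfand_shilov_integrable:
  assumes "f \<in> gelfand_shilov \<sigma>"
  shows "integrable lborel f"
proof -
  obtain w where "smooth f" "\<And>n x. (1 + x\<^sup>2) * norm (nth_deriv n f x) \<le> w n"
    using gelfand_shilovD[OF assms] by metis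
  from this(1) this(2)[of _ 0] show ?thesis
    by (intro integrable_quadratic_decay[of f "w 0"] borel_measurable_continuous_onI smooth_continuous)
       (auto simp: nth_deriv_def)
qed

lemma oscillatory_integral_gelfand_shilov:
  assumes "\<sigma> > 1" "f \<in> gelfand_shilov \<sigma>" "1 \<le> \<bar>s\<bar>"
  shows "oscillatory_integral s f \<in> gelfand_shilov \<sigma>"
proof -
  obtain w where w: "smooth f" "wbdd \<sigma> w" "\<And>n x. \<bar>x\<bar> ^ n * norm (f x) \<le> w n"
    "\<And>n x. (1 + x\<^sup>2) * norm (nth_deriv n f x) \<le> w n"
    using gelfand_shilovD[OF assms(2)] by metis
  have nn: "0 \<le> w n" for n using order_trans[OF _ w(3)[of 0 n]] by simp
  note m = borel_measurable_continuous_onI[OF smooth_continuous[OF w(1)]]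
  show ?thesis
  proof (rule gelfand_shilovI[OF assms(1)])
    show "smooth (oscillatory_integral s f)" by (rule smooth_oscillatory_integral[OF m w(3)])
    show "wbdd \<sigma> (\<lambda>n. cauchy_mass * w n)"
      using nn cauchy_mass_nonneg by (intro wbdd_mult wbdd_const w)
    \<comment> \<open>The index is written \<open>1 * n + 2\<close> to match
      \<open>wbdd_affine\<close>.\<close>
    show "wbdd \<sigma> (\<lambda>n. cauchy_mass * (\<bar>s\<bar> ^ n * (w n + w (1 * n + 2))))"
      using nn cauchy_mass_nonneg assms(1)
      by (intro wbdd_mult wbdd_add wbdd_const wbdd_power w(2) wbdd_affine[OF w(2)]) (auto intro: add_nonneg_nonneg)
    show "\<bar>\<xi>\<bar> ^ n * norm (oscillatory_integral s f \<xi>) \<le> cauchy_mass * w n" for n \<xi>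
      by (rule oscillatory_integral_decay[OF w(1,4) assms(3)])
    show "norm (nth_deriv n (oscillatory_integral s f) \<xi>) \<le> cauchy_mass * (\<bar>s\<bar> ^ n * (w n + w (1 * n + 2)))" for n \<xi>
      using norm_deriv_oscillatory_integral_le[OF m w(3), of n s \<xi>] by simp
  qed
qed

lemma gelfand_shilov_of_admissible:
  assumes "\<sigma> > 1" "smooth f" "admissible \<alpha> \<beta>" "\<tau> > 0" "C > 0"
    and "\<And>n x. norm (x ^ \<alpha> n *\<^sub>R f x) \<le> C * weight \<tau> \<sigma> (\<alpha> n)"
    and "\<And>n x. norm (nth_deriv (\<beta> n) f x) \<le> C * weight \<tau> \<sigma> (\<beta> n)"
  shows "f \<in> gelfand_shilov \<sigma>"
proof -
  obtain K c :: nat where gap: "\<And>n. \<exists>k. n \<le> \<alpha> k \<and> \<alpha> k \<le> K * n + c" "\<And>n. \<exists>k. n \<le> \<beta> k \<and> \<beta> k \<le> K * n + c"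
    using admissible_gap[OF assms(3)] by blast
  have 0: "\<alpha> 0 = 0" "\<beta> 0 = 0" using assms(3) by (auto simp: admissible_def)
  have s: "0 \<le> \<sigma>" "1 \<le> \<sigma>" using assms(1) by auto
  obtain u where u: "wbdd \<sigma> u" "\<And>n x. \<bar>x\<bar> ^ n * norm (f x) \<le> u n"
    using fill_gaps_decay[OF gap(1) 0(1) s(1) assms(4,5,6)] by blast
  obtain v where v: "wbdd \<sigma> v" "\<And>n x. norm (nth_deriv n f x) \<le> v n"
    using fill_gaps_deriv[OF gap(2) 0(2) s(2) assms(4,5,2,7)] by blast
  show ?thesis by (rule gelfand_shilovI[OF assms(1,2) u(1) v(1) u(2) v(2)])
qed

text \<open>The moments of g of orders 0 and 2 make it integrable, so f is its inverse integral, and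
  the higher moments of g bound the derivatives of f.\<close>

lemma gelfand_shilov_of_fourier_decay:
  assumes "\<sigma> > 1" "smooth f" "has_fourier_transform f g" "admissible \<alpha> \<beta>" "\<tau> > 0" "C > 0"
    and "\<And>n x. norm (x ^ \<alpha> n *\<^sub>R f x) \<le> C * weight \<tau> \<sigma> (\<alpha> n)"
    and "\<And>n x. norm (x ^ \<beta> n *\<^sub>R g x) \<le> C * weight \<tau> \<sigma> (\<beta> n)"
  shows "f \<in> gelfand_shilov \<sigma>"
proof -
  obtain K c :: nat where gap: "\<And>n. \<exists>k. n \<le> \<alpha> k \<and> \<alpha> k \<le> K * n + c" "\<And>n. \<exists>k. n \<le> \<beta> k \<and> \<beta> k \<le> K * n + c"
    using admissible_gap[OF assms(4)] by blast
  have 0: "\<alpha> 0 = 0" "\<beta> 0 = 0" using assms(4) by (auto simp: admissible_def)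
  have s0: "0 \<le> \<sigma>" using assms(1) by simp
  obtain u where u: "wbdd \<sigma> u" "\<And>n x. \<bar>x\<bar> ^ n * norm (f x) \<le> u n"
    using fill_gaps_decay[OF gap(1) 0(1) s0 assms(5,6,7)] by blast
  obtain v where v: "wbdd \<sigma> v" "\<And>n x. \<bar>x\<bar> ^ n * norm (g x) \<le> v n"
    using fill_gaps_decay[OF gap(2) 0(2) s0 assms(5,6,8)] by blast
  have nn: "0 \<le> v n" for n using order_trans[OF _ v(2)[of 0 n]] by simp
  have m: "g \<in> borel_measurable borel"
    using assms(3) by (auto simp: has_fourier_transform_def intro: borel_measurable_continuous_onI)
  have "integrable lborel g"
    by (rule integrable_quadratic_decay[OF m, of "v 0 + v 2"])
       (use v(2)[of _ 0] v(2)[of _ 2] in \<open>simp add: distrib_right add_mono\<close>)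
  then have f: "f = oscillatory_integral (2 * pi) g"
    by (rule fourier_inversion[OF assms(3) smooth_continuous[OF assms(2)]])
  show ?thesis
  proof (rule gelfand_shilovI[OF assms(1,2) u(1) _ u(2)])
    show "wbdd \<sigma> (\<lambda>n. cauchy_mass * (\<bar>2 * pi\<bar> ^ n * (v n + v (1 * n + 2))))"
      using nn cauchy_mass_nonneg assms(1)
      by (intro wbdd_mult wbdd_add wbdd_const wbdd_power v(1) wbdd_affine[OF v(1)]) (auto intro: add_nonneg_nonneg)
    show "norm (nth_deriv n f x) \<le> cauchy_mass * (\<bar>2 * pi\<bar> ^ n * (v n + v (1 * n + 2)))" for n x
      using norm_deriv_oscillatory_integral_le[OF m v(2), of n "2 * pi" x] f by simp
  qed
qed

section \<open>The associated function\<close>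

text \<open>For x > 0, once k >= 1 and ln x <= \<tau> ln k, the power x^k is at most the weight, so
  only finitely many exponents give a positive logarithm. For x = 0 every term is 0, by the
  convention ln 0 = 0.\<close>

lemma assoc_fun_bdd_above:
  assumes "\<tau> > 0" "\<sigma> \<ge> 1" "x \<ge> 0"
  shows "bdd_above (range (\<lambda>n. ln (x ^ d n / weight \<tau> \<sigma> (d n))))"
proof (cases "x = 0")
  case True
  then have "range (\<lambda>n. ln (x ^ d n / weight \<tau> \<sigma> (d n))) \<subseteq> {0}"
    by (auto simp: power_0_left weight_0)
  then show ?thesis by (rule bdd_above_mono[rotated]) simp
next
  case False
  then have x: "x > 0" using assms by simp
  define H where "H k = ln (x ^ k / weight \<tau> \<sigma> k)" for k
  have "filterlim (\<lambda>k::nat. \<tau> * ln (real k)) at_top at_top" using assms(1) by real_asymp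
  then have "eventually (\<lambda>k. ln x \<le> \<tau> * ln (real k)) sequentially"
    unfolding filterlim_at_top by blast
  then obtain N where N: "\<And>k. k \<ge> N \<Longrightarrow> ln x \<le> \<tau> * ln (real k)"
    unfolding eventually_sequentially by blast
  have H: "H k \<le> 0" if "k \<ge> max N 1" for k
  proof -
    have k: "real k \<ge> 1" using that by simp
    have "x ^ k = exp (real k * ln x)" using x by (simp add: exp_of_nat_mult)
    also have "\<dots> \<le> exp (real k powr 1 * (\<tau> * ln (real k)))"
      using N[of k] that k by (simp add: mult_left_mono)
    also have "\<dots> \<le> exp (real k powr \<sigma> * (\<tau> * ln (real k)))"
      unfolding exp_le_cancel_iff using k assms by (intro mult_right_mono powr_mono) auto
    also have "\<dots> = weight \<tau> \<sigma> k"
      using k by (simp add: weight_def powr_def[of "real k" "\<tau> * real k powr \<sigma>"] mult_ac)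
    finally have "x ^ k \<le> weight \<tau> \<sigma> k" .
    moreover have "0 < weight \<tau> \<sigma> k" using weight_ge_1[of \<tau> \<sigma> k] assms(1) by simp
    ultimately show ?thesis unfolding H_def using x by (subst ln_le_zero_iff) auto
  qed
  have "range (\<lambda>n. H (d n)) \<subseteq> H ` {..<max N 1} \<union> {..0}" 
  proof (rule image_subsetI)
    fix n
    show "H (d n) \<in> H ` {..<max N 1} \<union> {..0}" using H[of "d n"] 
      by (cases "d n < max N 1") (auto simp: less_max_iff_disj not_less)
  qed
  then show ?thesis unfolding H_def by (rule bdd_above_mono[rotated]) (simp add: bdd_above_Un)
qed

text \<open>Away from x = 0, the exponential of the supremum is the supremum of |x|^(d n) / weight,
  so one bound on the product amounts to the moment bounds for all n with a common constant.\<close>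

lemma assoc_fun_bound_iff:
  fixes f :: "real \<Rightarrow> 'a::real_normed_vector"
  assumes \<tau>: "\<tau> > 0" and \<sigma>: "\<sigma> \<ge> 1" and d: "d 0 = 0"
  shows "bdd_above (range (\<lambda>x. norm (f x) * exp (assoc_fun \<tau> \<sigma> d \<bar>x\<bar>))) \<longleftrightarrow>
    (\<exists>C>0. \<forall>n x. norm (x ^ d n *\<^sub>R f x) \<le> C * weight \<tau> \<sigma> (d n))"
proof -
  have w: "0 < weight \<tau> \<sigma> n" for n using weight_ge_1[of \<tau> \<sigma> n] \<tau> by simp
  show ?thesis
  proof
    assume "bdd_above (range (\<lambda>x. norm (f x) * exp (assoc_fun \<tau> \<sigma> d \<bar>x\<bar>)))"
    then obtain B where B: "\<And>x. norm (f x) * exp (assoc_fun \<tau> \<sigma> d \<bar>x\<bar>) \<le> B"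
      unfolding bdd_above_def by blast
    have "norm (x ^ d n *\<^sub>R f x) \<le> (\<bar>B\<bar> + 1) * weight \<tau> \<sigma> (d n)" for n x
    proof (cases "x ^ d n = 0")
      case True
      show ?thesis unfolding True using w[of "d n"] by simp
    next
      case False
      define q where "q = \<bar>x\<bar> ^ d n / weight \<tau> \<sigma> (d n)"
      have q: "q > 0" using False w by (auto simp: q_def)
      have "ln q \<le> assoc_fun \<tau> \<sigma> d \<bar>x\<bar>"
        unfolding q_def assoc_fun_def by (rule cSUP_upper[OF _ assoc_fun_bdd_above]) (use \<tau> \<sigma> in auto)
      then have "exp (ln q) \<le> exp (assoc_fun \<tau> \<sigma> d \<bar>x\<bar>)" by (simp only: exp_le_cancel_iff)
      then have "q \<le> exp (assoc_fun \<tau> \<sigma> d \<bar>x\<bar>)" using q by simp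
      then have "norm (f x) * q \<le> norm (f x) * exp (assoc_fun \<tau> \<sigma> d \<bar>x\<bar>)" by (intro mult_left_mono) auto
      also have "\<dots> \<le> \<bar>B\<bar> + 1" using B[of x] by linarith
      finally show ?thesis using w[of "d n"] by (simp add: q_def field_simps power_abs)
    qed
    then show "\<exists>C>0. \<forall>n x. norm (x ^ d n *\<^sub>R f x) \<le> C * weight \<tau> \<sigma> (d n)"
      by (intro exI[of _ "\<bar>B\<bar> + 1"]) auto
  next
    assume "\<exists>C>0. \<forall>n x. norm (x ^ d n *\<^sub>R f x) \<le> C * weight \<tau> \<sigma> (d n)"
    then obtain C where C: "C > 0" "\<And>n x. norm (x ^ d n *\<^sub>R f x) \<le> C * weight \<tau> \<sigma> (d n)" by blast
    have "norm (f x) * exp (assoc_fun \<tau> \<sigma> d \<bar>x\<bar>) \<le> C" for x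
    proof (cases "f x = 0")
      case False
      then have fx: "norm (f x) > 0" by simp
      have "assoc_fun \<tau> \<sigma> d \<bar>x\<bar> \<le> ln (C / norm (f x))"
        unfolding assoc_fun_def
      proof (rule cSUP_least)
        fix n
        show "ln (\<bar>x\<bar> ^ d n / weight \<tau> \<sigma> (d n)) \<le> ln (C / norm (f x))"
        proof (cases "x = 0")
          case True
          \<comment> \<open>Since ln 0 = 0, the right-hand logarithm must be non-negative here; the
            moment bound of index 0 provides this because d 0 = 0.\<close>
          have "1 \<le> C / norm (f x)" using C(2)[of x 0] d fx by (simp add: weight_0)
          then show ?thesis using True by (simp add: power_0_left weight_0)
        next
          case False
          then have "0 < \<bar>x\<bar> ^ d n / weight \<tau> \<sigma> (d n)" using w by simp
          moreover have "\<bar>x\<bar> ^ d n / weight \<tau> \<sigma> (d n) \<le> C / norm (f x)"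
            using C(2)[of x n] w[of "d n"] fx by (simp add: field_simps power_abs)
          ultimately show ?thesis using C fx by simp
        qed
      qed simp
      then have "exp (assoc_fun \<tau> \<sigma> d \<bar>x\<bar>) \<le> exp (ln (C / norm (f x)))" by (simp only: exp_le_cancel_iff)
      also have "\<dots> = C / norm (f x)" using C fx by (subst exp_ln) auto
      finally show ?thesis using C fx by (simp add: field_simps)
    qed (use C in simp)
    then show "bdd_above (range (\<lambda>x. norm (f x) * exp (assoc_fun \<tau> \<sigma> d \<bar>x\<bar>)))"
      unfolding bdd_above_def by blast
  qed
qed

text \<open>Membership in the space bounds all orders, so the identity can serve as both sequences;
  L = 2 works because (n + 1) / n <= 2 for n >= 1.\<close>

lemma admissible_id: "admissible (\<lambda>n. n) (\<lambda>n. n)"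
  unfolding admissible_def
  by (auto simp: strict_mono_def filterlim_ident field_simps intro!: exI[of _ "2 :: real"])

theorem theorem4p6:
  fixes \<sigma> :: real and \<phi> :: "real \<Rightarrow> complex"
  assumes "\<sigma> > 1" and "smooth \<phi>"
  defines "cond1 \<equiv> \<phi> \<in> gelfand_shilov \<sigma>"
    and "cond2 \<equiv>
      (\<exists>\<alpha> \<beta>. admissible \<alpha> \<beta> \<and> (\<exists>\<tau>>0. \<exists>C>0. \<forall>m n.
         (\<forall>x. norm (x ^ \<alpha> n *\<^sub>R \<phi> x) \<le> C * weight \<tau> \<sigma> (\<alpha> n)) \<and>
         (\<forall>x. norm (nth_deriv (\<beta> m) \<phi> x) \<le> C * weight \<tau> \<sigma> (\<beta> m))))"
    and "cond3 \<equiv>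
      (\<exists>\<phi>hat. has_fourier_transform \<phi> \<phi>hat \<and>
       (\<exists>\<alpha> \<beta>. admissible \<alpha> \<beta> \<and> (\<exists>\<tau>>0. \<exists>C>0. \<forall>m n.
         (\<forall>x. norm (x ^ \<alpha> n *\<^sub>R \<phi> x) \<le> C * weight \<tau> \<sigma> (\<alpha> n)) \<and>
         (\<forall>\<xi>. norm (\<xi> ^ \<beta> m *\<^sub>R \<phi>hat \<xi>) \<le> C * weight \<tau> \<sigma> (\<beta> m)))))"
    and "cond4 \<equiv>
      (\<exists>\<phi>hat. has_fourier_transform \<phi> \<phi>hat \<and> smooth \<phi>hat \<and>
       (\<exists>\<alpha> \<beta>. admissible \<alpha> \<beta> \<and> (\<exists>\<tau>>0. \<exists>C>0. \<forall>m n.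
         (\<forall>\<xi>. norm (nth_deriv (\<alpha> n) \<phi>hat \<xi>) \<le> C * weight \<tau> \<sigma> (\<alpha> n)) \<and>
         (\<forall>\<xi>. norm (\<xi> ^ \<beta> m *\<^sub>R \<phi>hat \<xi>) \<le> C * weight \<tau> \<sigma> (\<beta> m)))))"
    and "cond5 \<equiv>
      (\<exists>\<phi>hat. has_fourier_transform \<phi> \<phi>hat \<and>
       (\<exists>\<alpha> \<beta>. admissible \<alpha> \<beta> \<and> (\<exists>\<tau>>0.
         bdd_above (range (\<lambda>x. norm (\<phi> x) * exp (assoc_fun \<tau> \<sigma> \<alpha> \<bar>x\<bar>))) \<and>
         bdd_above (range (\<lambda>\<xi>. norm (\<phi>hat \<xi>) * exp (assoc_fun \<tau> \<sigma> \<beta> \<bar>\<xi>\<bar>))))))"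
  shows "(cond1 \<longleftrightarrow> cond2) \<and> (cond1 \<longleftrightarrow> cond3) \<and> (cond1 \<longleftrightarrow> cond4) \<and> (cond1 \<longleftrightarrow> cond5)"
proof -
  have c12: cond2 and c13: cond3 and c14: cond4 if c1: cond1
  proof -
    have \<phi>: "\<phi> \<in> gelfand_shilov \<sigma>" using c1 by (simp add: cond1_def)
    \<comment> \<open>As \<phi> is integrable, the integral represents its distributional transform
      and is the witness for \<open>\<phi>hat\<close>.\<close>
    define g where "g = fourier_integral \<phi>"
    have ft: "has_fourier_transform \<phi> g"
      unfolding g_def by (intro has_fourier_transform_fourier_integral gelfand_shilov_integrable[OF \<phi>])
    have "1 \<le> \<bar>- (2 * pi)\<bar>" using pi_ge_two by simp
    then have g: "g \<in> gelfand_shilov \<sigma>"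
      unfolding g_def fourier_integral_eq_oscillatory by (rule oscillatory_integral_gelfand_shilov[OF assms(1) \<phi>])
    obtain u where u: "wbdd \<sigma> u" "\<And>n x. \<bar>x\<bar> ^ n * norm (\<phi> x) \<le> u n" "\<And>n x. norm (nth_deriv n \<phi> x) \<le> u n"
      using gelfand_shilovD[OF \<phi>] by metis
    obtain v where v: "smooth g" "wbdd \<sigma> v" "\<And>n x. \<bar>x\<bar> ^ n * norm (g x) \<le> v n" "\<And>n x. norm (nth_deriv n g x) \<le> v n"
      using gelfand_shilovD[OF g] by metis
    obtain \<tau> C where \<tau>: "\<tau> > 0" "C > 0" and C: "\<And>n. u n \<le> C * weight \<tau> \<sigma> n" "\<And>n. v n \<le> C * weight \<tau> \<sigma> n"
      using wbdd_common[OF u(1) v(2)] by metis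
    have b: "norm (x ^ n *\<^sub>R \<phi> x) \<le> C * weight \<tau> \<sigma> n" "norm (nth_deriv n \<phi> x) \<le> C * weight \<tau> \<sigma> n"
      "norm (x ^ n *\<^sub>R g x) \<le> C * weight \<tau> \<sigma> n" "norm (nth_deriv n g x) \<le> C * weight \<tau> \<sigma> n" for n x
      using order_trans[OF u(2) C(1), of x n] order_trans[OF u(3) C(1), of n x]
        order_trans[OF v(3) C(2), of x n] order_trans[OF v(4) C(2), of n x]
      by (simp_all add: power_abs)
    show cond2 unfolding cond2_def
      by (rule exI[of _ "\<lambda>n. n"], rule exI[of _ "\<lambda>n. n"], intro conjI exI[of _ \<tau>] exI[of _ C] allI admissible_id \<tau> b)
    show cond3 unfolding cond3_def
      by (rule exI[of _ g], rule conjI[OF ft], rule exI[of _ "\<lambda>n. n"], rule exI[of _ "\<lambda>n. n"],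
          intro conjI exI[of _ \<tau>] exI[of _ C] allI admissible_id \<tau> b)
    show cond4 unfolding cond4_def
      by (rule exI[of _ g], rule conjI[OF ft], rule conjI[OF v(1)], rule exI[of _ "\<lambda>n. n"], rule exI[of _ "\<lambda>n. n"],
          intro conjI exI[of _ \<tau>] exI[of _ C] allI admissible_id \<tau> b)
  qed
  have c21: cond1 if c2: cond2
  proof -
    obtain \<alpha> \<beta> \<tau> C where "admissible \<alpha> \<beta>" "\<tau> > 0" "C > 0"
      "\<And>n x. norm (x ^ \<alpha> n *\<^sub>R \<phi> x) \<le> C * weight \<tau> \<sigma> (\<alpha> n)" "\<And>n x. norm (nth_deriv (\<beta> n) \<phi> x) \<le> C * weight \<tau> \<sigma> (\<beta> n)"
      using c2 unfolding cond2_def by blast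
    then show cond1 unfolding cond1_def by (rule gelfand_shilov_of_admissible[OF assms(1,2)])
  qed
  have c31: cond1 if c3: cond3
  proof -
    obtain g \<alpha> \<beta> \<tau> C where "has_fourier_transform \<phi> g" "admissible \<alpha> \<beta>" "\<tau> > 0" "C > 0"
      "\<And>n x. norm (x ^ \<alpha> n *\<^sub>R \<phi> x) \<le> C * weight \<tau> \<sigma> (\<alpha> n)" "\<And>n x. norm (x ^ \<beta> n *\<^sub>R g x) \<le> C * weight \<tau> \<sigma> (\<beta> n)"
      using c3 unfolding cond3_def by blast
    then show cond1 unfolding cond1_def by (rule gelfand_shilov_of_fourier_decay[OF assms(1,2)])
  qed
  have c41: cond1 if c4: cond4
  proof -
    obtain g \<alpha> \<beta> \<tau> C where g: "has_fourier_transform \<phi> g" "smooth g" and adm: "admissible \<alpha> \<beta>" and "\<tau> > 0" "C > 0"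
      and "\<And>n x. norm (nth_deriv (\<alpha> n) g x) \<le> C * weight \<tau> \<sigma> (\<alpha> n)" "\<And>n x. norm (x ^ \<beta> n *\<^sub>R g x) \<le> C * weight \<tau> \<sigma> (\<beta> n)"
      using c4 unfolding cond4_def by blast
    \<comment> \<open>Here \<alpha> indexes derivatives of g and \<beta> its moments, so the pair is
      swapped before the criterion is applied to g.\<close>
    moreover have "admissible \<beta> \<alpha>" using adm unfolding admissible_def by blast
    ultimately have G: "g \<in> gelfand_shilov \<sigma>" using assms(1) by (intro gelfand_shilov_of_admissible)
    \<comment> \<open>No decay of \<phi> is assumed in this case; membership is proved for g first
      and carried back by inversion.\<close>
    have "\<phi> = oscillatory_integral (2 * pi) g"
      by (rule fourier_inversion[OF g(1) smooth_continuous[OF assms(2)] gelfand_shilov_integrable[OF G]])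
    moreover have "oscillatory_integral (2 * pi) g \<in> gelfand_shilov \<sigma>"
      using pi_ge_two by (intro oscillatory_integral_gelfand_shilov[OF assms(1) G]) simp
    ultimately show cond1 by (simp add: cond1_def)
  qed
  have bound_iff: "(\<exists>C>0. \<forall>m n. (\<forall>x. norm (x ^ \<alpha> n *\<^sub>R \<phi> x) \<le> C * weight \<tau> \<sigma> (\<alpha> n)) \<and>
         (\<forall>\<xi>. norm (\<xi> ^ \<beta> m *\<^sub>R g \<xi>) \<le> C * weight \<tau> \<sigma> (\<beta> m))) \<longleftrightarrow>
      bdd_above (range (\<lambda>x. norm (\<phi> x) * exp (assoc_fun \<tau> \<sigma> \<alpha> \<bar>x\<bar>))) \<and>
      bdd_above (range (\<lambda>\<xi>. norm (g \<xi>) * exp (assoc_fun \<tau> \<sigma> \<beta> \<bar>\<xi>\<bar>)))"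
    if "\<tau> > 0" "admissible \<alpha> \<beta>" for \<tau> \<alpha> \<beta> and g :: "real \<Rightarrow> complex"
  proof -
    have "\<alpha> 0 = 0" "\<beta> 0 = 0" "\<sigma> \<ge> 1" using that assms(1) by (auto simp: admissible_def)
    note iff = assoc_fun_bound_iff[where d = \<alpha> and f = \<phi>, OF that(1) this(3,1)]
      assoc_fun_bound_iff[where d = \<beta> and f = g, OF that(1) this(3,2)]
    show ?thesis (is "?L \<longleftrightarrow> ?R")
    proof
      assume ?L
      then show ?R unfolding iff by blast
    next
      assume ?R
      then obtain a b where a: "a > 0" "\<And>n x. norm (x ^ \<alpha> n *\<^sub>R \<phi> x) \<le> a * weight \<tau> \<sigma> (\<alpha> n)"
        and b: "b > 0" "\<And>n x. norm (x ^ \<beta> n *\<^sub>R g x) \<le> b * weight \<tau> \<sigma> (\<beta> n)"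
        unfolding iff by blast
      \<comment> \<open>The two halves provide separate constants a and b, while
        \<open>cond3\<close> asks for one; their sum serves both.\<close>
      have m: "a * weight \<tau> \<sigma> n \<le> (a + b) * weight \<tau> \<sigma> n" "b * weight \<tau> \<sigma> n \<le> (a + b) * weight \<tau> \<sigma> n" for n
        using weight_ge_1[of \<tau> \<sigma> n] that a(1) b(1) by (intro mult_right_mono; simp)+
      show ?L
        by (rule exI[of _ "a + b"]) (use a(1) b(1) order_trans[OF a(2) m(1)] order_trans[OF b(2) m(2)] in simp)
    qed
  qed
  have "cond3 \<longleftrightarrow> cond5"
    unfolding cond3_def cond5_def by (intro ex_cong1 conj_cong refl bound_iff)
  with c12 c13 c14 c21 c31 c41 show ?thesis by blast
qed

end
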